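(* Let $n\geq k\ge 1$ be odd integers such that one of the following holds: (1) $\gcd(n,k-1)=1$; (2) $3<k<200$; (3) $n\geq (k-2)(k-1)$. Then there exists a biembedding of $K_{2nk+1}$ into an orientable surface $\Sigma$ whose face lengths are multiples of $k$.
   Context: $K_v$ is the complete graph on $v$ vertices. An embedding of a graph $\Gamma$ in a surface $\Sigma$ is a continuous injective map $\psi:\Gamma\to\Sigma$, where $\Gamma$ is viewed with the usual topology as a 1-dimensional simplicial complex; its faces are the connected components of $\Sigma\setminus\psi(\Gamma)$. A circuit is a closed trail (edges are not repeated, vertices may be), and a circuit decomposition of $\Gamma$ is a set of circuits whose edge-sets partition $E(\Gamma)$. A biembedding of $\Gamma$ is a face 2-colorable embedding of $\Gamma$ (faces colored with two colors so that each edge lies on the boundary of one face of each color) for which there are two circuit decompositions $\mathcal{D},\mathcal{D}'$ of $\Gamma$ such that the boundaries of the faces in one color class are the circuits of $\mathcal{D}$ and those in the other color class are the circuits of $\mathcal{D}'$. The length of a face is the number of edges of its boundary circuit. *)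

theory Defs
  imports "HOL-Complex_Analysis.Complex_Analysis"
begin

section \<open>Orientable surfaces\<close>

definition plane_chart :: "'p topology \<Rightarrow> 'p set \<Rightarrow> ('p \<Rightarrow> complex) \<Rightarrow> bool" where
  "plane_chart S U \<phi> \<longleftrightarrow>
     openin S U \<and> open (\<phi> ` U) \<and>
     homeomorphic_map (subtopology S U) (top_of_set (\<phi> ` U)) \<phi>"

text \<open>Surfaces are closed: compact, connected, without boundary. Second countability follows
  from compactness. The topology is abstract, so any point type with at least continuum many
  elements carries a homeomorphic copy of every surface.\<close>

definition surface :: "'p topology \<Rightarrow> bool" where
  "surface S \<longleftrightarrow>
     Hausdorff_space S \<and> compact_space S \<and> connected_space S \<and>
     (\<forall>x\<in>topspace S. \<exists>U \<phi>. x \<in> U \<and> plane_chart S U \<phi>)"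

text \<open>Intended for homeomorphisms \<open>f\<close> from an open set \<open>W\<close> onto an open set of the plane: a small
  circle around a point is mapped to a curve winding once, in the positive sense, around the
  image of that point. The winding number here is that of a continuous closed path.\<close>

definition orientation_preserving_on :: "complex set \<Rightarrow> (complex \<Rightarrow> complex) \<Rightarrow> bool" where
  "orientation_preserving_on W f \<longleftrightarrow>
     (\<forall>z r. 0 < r \<and> cball z r \<subseteq> W \<longrightarrow> winding_number (f \<circ> circlepath z r) (f z) = 1)"

definition orientable :: "'p topology \<Rightarrow> bool" where
  "orientable S \<longleftrightarrow>
     (\<exists>A. (\<forall>(U, \<phi>)\<in>A. plane_chart S U \<phi>) \<and>
          (\<Union>(U, \<phi>)\<in>A. U) = topspace S \<and>
          (\<forall>(U, \<phi>)\<in>A. \<forall>(V, \<theta>)\<in>A.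
             orientation_preserving_on (\<phi> ` (U \<inter> V)) (\<theta> \<circ> inv_into U \<phi>)))"

section \<open>Graphs and circuits\<close>

text \<open>A simple graph is given by its vertex set \<open>V\<close> and its set \<open>E\<close> of two-element edges.\<close>

definition complete_edges :: "'v set \<Rightarrow> 'v set set" where
  "complete_edges V = {e. e \<subseteq> V \<and> card e = 2}"

text \<open>Points of the simplex with vertex set \<open>s\<close>, in barycentric coordinates.\<close>

definition simplex_points :: "'v set \<Rightarrow> ('v \<Rightarrow> real) set" where
  "simplex_points s = {x. (\<forall>v. 0 \<le> x v) \<and> (\<forall>v. v \<notin> s \<longrightarrow> x v = 0) \<and> sum x s = 1}"

text \<open>The graph as a 1-dimensional simplicial complex. The product topology on functions
  induces the usual topology, as long as the graph is finite.\<close>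

definition graph_space :: "'v set \<Rightarrow> 'v set set \<Rightarrow> ('v \<Rightarrow> real) topology" where
  "graph_space V E =
     top_of_set ((\<Union>v\<in>V. simplex_points {v}) \<union> (\<Union>e\<in>E. simplex_points e))"

definition edge_point :: "'v \<Rightarrow> 'v \<Rightarrow> real \<Rightarrow> 'v \<Rightarrow> real" where
  "edge_point u v t = (\<lambda>w. (1 - t) * of_bool (w = u) + t * of_bool (w = v))"

text \<open>A circuit is represented by the list of the vertices it visits, without repeating the
  first one at the end, so its number of edges is the length of the list. Lists that differ by
  rotation or reversal represent the same circuit.\<close>

definition circuit_edge :: "'v list \<Rightarrow> nat \<Rightarrow> 'v set" where
  "circuit_edge c i = {c ! i, c ! (Suc i mod length c)}"

definition circuit_edges :: "'v list \<Rightarrow> 'v set set" where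
  "circuit_edges c = circuit_edge c ` {..<length c}"

definition circuit :: "'v set set \<Rightarrow> 'v list \<Rightarrow> bool" where
  "circuit E c \<longleftrightarrow>
     c \<noteq> [] \<and> circuit_edges c \<subseteq> E \<and> inj_on (circuit_edge c) {..<length c}"

definition circuit_decomposition :: "'v set set \<Rightarrow> 'v list set \<Rightarrow> bool" where
  "circuit_decomposition E D \<longleftrightarrow>
     (\<forall>c\<in>D. circuit E c) \<and> disjoint_family_on circuit_edges D \<and>
     (\<Union>c\<in>D. circuit_edges c) = E"

section \<open>Embeddings and biembeddings\<close>

definition graph_embedding ::
  "'v set \<Rightarrow> 'v set set \<Rightarrow> 'p topology \<Rightarrow> (('v \<Rightarrow> real) \<Rightarrow> 'p) \<Rightarrow> bool" where
  "graph_embedding V E S \<psi> \<longleftrightarrow>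
     continuous_map (graph_space V E) S \<psi> \<and> inj_on \<psi> (topspace (graph_space V E))"

definition faces ::
  "'v set \<Rightarrow> 'v set set \<Rightarrow> 'p topology \<Rightarrow> (('v \<Rightarrow> real) \<Rightarrow> 'p) \<Rightarrow> 'p set set" where
  "faces V E S \<psi> =
     connected_components_of
       (subtopology S (topspace S - \<psi> ` topspace (graph_space V E)))"

text \<open>The boundary of the face \<open>F\<close> is the circuit \<open>c\<close>: there is a collar \<open>h\<close>, defined on a closed
  annulus, whose outer circle runs along \<open>c\<close>, each edge being traversed linearly, while the rest
  of the annulus is embedded in \<open>F\<close>; the part of \<open>F\<close> not covered by the collar is compact, so
  that \<open>c\<close> is the whole boundary. A vertex may be met several times, which is why the
  frontier of \<open>F\<close>, as a set, does not determine the circuit. If \<open>F\<close> is an open disc whose closure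
  is the image of a closed disc with the boundary circle running along \<open>c\<close>, then such a collar is
  obtained by restriction; faces are not required to be discs.\<close>

definition face_boundary ::
  "'v set set \<Rightarrow> 'p topology \<Rightarrow> (('v \<Rightarrow> real) \<Rightarrow> 'p) \<Rightarrow> 'p set \<Rightarrow> 'v list \<Rightarrow> bool" where
  "face_boundary E S \<psi> F c \<longleftrightarrow>
     circuit E c \<and>
     (\<exists>h :: complex \<Rightarrow> 'p.
        continuous_map (top_of_set {z. 1/2 \<le> norm z \<and> norm z \<le> 1}) S h \<and>
        inj_on h {z. 1/2 \<le> norm z \<and> norm z < 1} \<and>
        h ` {z. 1/2 \<le> norm z \<and> norm z < 1} \<subseteq> F \<and>
        compactin S (F - h ` {z. 1/2 < norm z \<and> norm z < 1}) \<and>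
        (\<forall>i<length c. \<forall>t\<in>{0..1}.
           h (cis (2 * pi * (real i + t) / real (length c))) =
           \<psi> (edge_point (c ! i) (c ! (Suc i mod length c)) t)))"

definition bounded_by_circuits ::
  "'v set set \<Rightarrow> 'p topology \<Rightarrow> (('v \<Rightarrow> real) \<Rightarrow> 'p) \<Rightarrow> 'p set set \<Rightarrow> 'v list set \<Rightarrow> bool" where
  "bounded_by_circuits E S \<psi> C D \<longleftrightarrow>
     (\<exists>b. bij_betw b C D \<and> (\<forall>F\<in>C. face_boundary E S \<psi> F (b F)))"

definition edge_on_face ::
  "'p topology \<Rightarrow> (('v \<Rightarrow> real) \<Rightarrow> 'p) \<Rightarrow> 'v set \<Rightarrow> 'p set \<Rightarrow> bool" where
  "edge_on_face S \<psi> e F \<longleftrightarrow> \<psi> ` simplex_points e \<subseteq> S frontier_of F"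

definition biembedding ::
  "'v set \<Rightarrow> 'v set set \<Rightarrow> 'p topology \<Rightarrow> (('v \<Rightarrow> real) \<Rightarrow> 'p) \<Rightarrow> bool" where
  "biembedding V E S \<psi> \<longleftrightarrow>
     graph_embedding V E S \<psi> \<and>
     (\<exists>C C' D D'.
        C \<union> C' = faces V E S \<psi> \<and> C \<inter> C' = {} \<and>
        (\<forall>e\<in>E. (\<exists>!F. F \<in> C \<and> edge_on_face S \<psi> e F) \<and>
                (\<exists>!F. F \<in> C' \<and> edge_on_face S \<psi> e F)) \<and>
        circuit_decomposition E D \<and> circuit_decomposition E D' \<and>
        bounded_by_circuits E S \<psi> C D \<and> bounded_by_circuits E S \<psi> C' D')"

text \<open>The boundary circuit of a face is unique up to rotation and reversal, so its length is
  determined by the face.\<close>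

definition face_has_length ::
  "'v set set \<Rightarrow> 'p topology \<Rightarrow> (('v \<Rightarrow> real) \<Rightarrow> 'p) \<Rightarrow> 'p set \<Rightarrow> nat \<Rightarrow> bool" where
  "face_has_length E S \<psi> F l \<longleftrightarrow> (\<exists>c. face_boundary E S \<psi> F c \<and> length c = l)"

end

theory Submission
  imports Defs "HOL-Number_Theory.Cong"
begin

text \<open>
  Put \<open>m = n * k\<close>, an odd number, and \<open>v = 2 * m + 1\<close>. Reading the differences \<open>1, 2, \<dots>, m\<close> cyclically
  gives a closed walk on the integers modulo \<open>v\<close>; as \<open>1 + 2 + \<dots> + m\<close> is a unit modulo \<open>v\<close>, it is an
  Eulerian circuit of the complete graph. Glue two discs along this circuit and its negative. Around
  a vertex, consecutive edges leaving it have differences \<open>a\<close> and \<open>a - 2\<close> modulo \<open>m\<close>, and since \<open>m\<close> is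
  odd the corners at a vertex form a single cycle. Hence the result is a closed surface, and the
  graph is embedded in it with just two faces, both of length \<open>m * v\<close>, a multiple of \<open>k\<close>.

  The surface is realised inside a coordinate space: the graph lies there by its barycentric
  coordinates, and each disc is the cone over its boundary circuit, bent into three further
  coordinates. In terms of the upper half plane covering a punctured disc, the chart at a vertex is
  an \<open>m\<close>-th root of the displacement from a corner. All charts commute with a branched covering of
  the sphere, so the transition maps are holomorphic and the surface is orientable.
\<close>

section \<open>Holomorphic atlases\<close>

text \<open>A circuit that leaves \<open>x\<close> by the difference \<open>a\<close> has entered it
  by \<open>a - 1\<close> (cyclically), so seen from \<open>x\<close> this corner joins
  \<open>a\<close> to \<open>-(a - 1)\<close>, by which the negative circuit leaves \<open>x\<close>
  in turn. The differences \<open>1, ..., m\<close> and their negatives are all the nonzero residues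
  modulo \<open>v\<close>: every edge at \<open>x\<close> is exactly one ray of its rotation, and
  the two circuits run along each edge in opposite directions. The latter makes the orientations of
  the discs agree. Orientability is phrased by winding numbers for transition maps that are merely
  continuous. No formula for these maps is computed. The covering sends the graph to the unit circle
  and the vertices to 1, and wraps one disc \<open>N\<close> times over the inside of the circle,
  the other over the outside. It can ramify only at the centres of the discs and at the vertices,
  each of which lies in a single chart; so it is locally invertible on every overlap of two
  different charts.\<close>

lemma continuous_on_compact_quotient:
  fixes f :: "'a::topological_space \<Rightarrow> 'b::t2_space"
  assumes "compact K" "continuous_on K f" "continuous_on K (g \<circ> f)"
  shows "continuous_on (f ` K) g"
proof -
  \<comment> \<open>The preimage of \<open>C\<close> under \<open>g\<close> is the
    \<open>f\<close>-image of its preimage under the composite: a compact set, hence closed in the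
    Hausdorff target.\<close>
  have "closedin (top_of_set (f ` K)) (f ` K \<inter> g -` C)" if "closed C" for C
  proof -
    have "closedin (top_of_set K) (K \<inter> (g \<circ> f) -` C)"
      using assms(3) that continuous_closedin_preimage by blast
    then have "compact (K \<inter> (g \<circ> f) -` C)"
      using assms(1) closedin_compact by blast
    then have "compact (f ` (K \<inter> (g \<circ> f) -` C))"
      using assms(2) by (meson compact_continuous_image continuous_on_subset inf_le1)
    moreover have "f ` (K \<inter> (g \<circ> f) -` C) = f ` K \<inter> g -` C" by auto
    ultimately show ?thesis
      by (metis closed_closedin closed_subset compact_imp_closed inf_le1)
  qed
  then show ?thesis
    by (simp add: continuous_on_closed_vimage closedin_closed_eq)
       (metis (no_types, lifting) closedin_closed inf_commute continuous_closedin_preimage_eq continuous_on_closed_vimage)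
qed

text \<open>The difference quotient of \<open>f\<close> is that of \<open>h\<close> divided by that
  of \<open>g\<close> taken along \<open>f\<close>. Injectivity keeps \<open>f w\<close> away from
  \<open>f u\<close>, so the latter quotient makes sense and tends to \<open>D\<close>, which is
  nonzero.\<close>

lemma injective_lift_field_differentiable:
  fixes f g h :: "complex \<Rightarrow> complex"
  assumes "open W" "u \<in> W" "continuous_on W f" "inj_on f W"
    and g: "(g has_field_derivative D) (at (f u))" and "D \<noteq> 0"
    and h: "(h has_field_derivative D') (at u)"
    and gf: "\<And>w. w \<in> W \<Longrightarrow> g (f w) = h w"
  shows "(f has_field_derivative D' / D) (at u)"
proof -
  have W: "\<forall>\<^sub>F w in at u. w \<in> W" "\<forall>\<^sub>F w in at u. w \<noteq> u"
    using assms(1,2) by (auto simp: eventually_at_topological)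
  have "isCont f u"
    using assms(1-3) continuous_on_eq_continuous_at by blast
  moreover have "\<forall>\<^sub>F w in at u. f w \<noteq> f u"
    using W by eventually_elim (use assms(2,4) in \<open>auto dest: inj_onD\<close>)
  ultimately have "filterlim f (at (f u)) (at u)"
    by (simp add: filterlim_at isCont_def)
  with g have "((\<lambda>w. (g (f w) - g (f u)) / (f w - f u)) \<longlongrightarrow> D) (at u)"
    unfolding has_field_derivative_iff by (rule filterlim_compose)
  with h \<open>D \<noteq> 0\<close> have "((\<lambda>w. ((h w - h u) / (w - u)) / ((g (f w) - g (f u)) / (f w - f u))) \<longlongrightarrow> D' / D) (at u)"
    unfolding has_field_derivative_iff by (intro tendsto_divide)
  moreover have "\<forall>\<^sub>F w in at u. g (f w) \<noteq> g (f u)"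
  proof -
    have "\<forall>\<^sub>F w in at u. (g (f w) - g (f u)) / (f w - f u) \<noteq> 0"
      using \<open>((\<lambda>w. (g (f w) - g (f u)) / (f w - f u)) \<longlongrightarrow> D) (at u)\<close> \<open>D \<noteq> 0\<close>
      by (rule tendsto_imp_eventually_ne)
    then show ?thesis by eventually_elim auto
  qed
  then have "\<forall>\<^sub>F w in at u. ((h w - h u) / (w - u)) / ((g (f w) - g (f u)) / (f w - f u))
      = (f w - f u) / (w - u)"
    using W by eventually_elim (use assms(2) gf in \<open>auto simp: divide_divide_eq_right\<close>)
  ultimately show ?thesis
    unfolding has_field_derivative_iff by (simp add: filterlim_cong)
qed

text \<open>By the argument principle the winding number counts the zeros of
  \<open>f w - f z\<close> inside the circle. Injectivity leaves only \<open>z\<close>, and this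
  zero is simple because the derivative of an injective holomorphic function does not
  vanish.\<close>

lemma winding_number_injective_holomorphic_circle:
  assumes "f holomorphic_on W" "open W" "inj_on f W" "0 < r" "cball z r \<subseteq> W"
  shows "winding_number (f \<circ> circlepath z r) (f z) = 1"
proof -
  \<comment> \<open>The argument principle needs an open domain around the closed disc; compactness
    provides a margin \<open>e\<close>.\<close>
  obtain e where e: "0 < e" "(\<Union>x\<in>cball z r. cball x e) \<subseteq> W"
    using compact_subset_open_imp_cball_epsilon_subset[of "cball z r" W] assms by auto
  define R where "R = r + e"
  have R: "r < R" "cball z R \<subseteq> W"
  proof -
    show "r < R" using e by (simp add: R_def)
    show "cball z R \<subseteq> W"
    proof
      fix w assume w: "w \<in> cball z R"
      \<comment> \<open>\<open>y\<close> divides the segment from \<open>z\<close> to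
        \<open>w\<close> in the ratio \<open>r : e\<close>, so it lies in the disc of radius
        \<open>r\<close> and within \<open>e\<close> of \<open>w\<close>.\<close>
      define y where "y = z + of_real (r / R) * (w - z)"
      have "norm (y - z) = r / R * norm (w - z)" "norm (w - y) = e / R * norm (w - z)"
      proof -
        have "w - y = of_real (e / R) * (w - z)"
        proof -
          have "e / R = 1 - r / R" using e assms(4) by (simp add: R_def field_simps)
          then show ?thesis by (simp only: y_def of_real_diff of_real_1) (simp add: algebra_simps)
        qed
        then show "norm (w - y) = e / R * norm (w - z)"
          using e assms(4) by (simp only: norm_mult norm_of_real) (simp add: R_def)
      qed (use e assms(4) in \<open>simp add: y_def R_def norm_mult del: of_real_divide of_real_add\<close>)
      moreover have "norm (w - z) / R \<le> 1"
        using w e assms(4) by (simp add: dist_norm norm_minus_commute R_def)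
      then have "r * (norm (w - z) / R) \<le> r" "e * (norm (w - z) / R) \<le> e"
        using e assms(4) by (simp_all only: mult_left_le less_imp_le)
      ultimately have "norm (y - z) \<le> r" "norm (w - y) \<le> e"
        by simp_all
      then have "y \<in> cball z r" "w \<in> cball y e"
        by (auto simp: dist_norm norm_minus_commute)
      then show "w \<in> W" using e(2) by blast
    qed
  qed
  let ?B = "ball z R"
  let ?F = "\<lambda>w. f w - f z"
  let ?c = "circlepath z r"
  have zB: "z \<in> ?B" using R assms by auto
  have BW: "?B \<subseteq> W" using R ball_subset_cball by blast
  have fB: "f holomorphic_on ?B" using assms(1) BW holomorphic_on_subset by blast
  have im: "path_image ?c \<subseteq> ?B - {z}"
    using R assms(4) by (auto simp: path_image_circlepath)
  have ne: "f w \<noteq> f z" if "w \<in> ?B" "w \<noteq> z" for w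
    using inj_on_eq_iff[OF assms(3), of w z] that subsetD[OF BW zB] subsetD[OF BW, of w] by blast
  have z: "{w\<in>?B. ?F w = 0 \<or> w \<in> {}} = {z}"
    using ne zB by auto
  have dz: "deriv f z \<noteq> 0"
    using assms(1-3) zB BW holomorphic_injective_imp_regular by blast
  \<comment> \<open>The cofactor in \<open>f w - f z = (w - z) * g w\<close>; being nonzero at
    \<open>z\<close>, it witnesses that the order of the zero is 1.\<close>
  define g where "g = (\<lambda>w. if w = z then deriv f z else (f w - f z) / (w - z))"
  have g: "g holomorphic_on ?B"
    unfolding g_def by (rule pole_lemma_open[OF fB]) auto
  have ord: "zorder ?F z = 1"
    by (rule zorder_eqI[OF _ zB g]) (use dz zB in \<open>auto simp: g_def\<close>)
  have "contour_integral ?c (\<lambda>x. deriv ?F x * 1 / ?F x) = 2 * pi * \<i> *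
      (\<Sum>p\<in>{w\<in>?B. ?F w = 0 \<or> w \<in> {}}. winding_number ?c p * 1 * zorder ?F p)"
  proof (rule argument_principle)
    show "\<forall>w. w \<notin> ?B \<longrightarrow> winding_number ?c w = 0"
      using R assms(4) by (auto intro!: winding_number_zero_outside[of _ "cball z r"] simp: path_image_circlepath)
    show "path_image (circlepath z r) \<subseteq> ball z R - {w \<in> ball z R. f w - f z = 0 \<or> w \<in> {}}"
      unfolding z by (rule im)
    show "finite {w \<in> ball z R. f w - f z = 0 \<or> w \<in> {}}" unfolding z by simp
  qed (use fB in \<open>auto intro!: holomorphic_intros\<close>)
  then have "contour_integral ?c (\<lambda>x. deriv ?F x / ?F x) = 2 * pi * \<i>"
    unfolding z using ord assms(4) by (simp add: winding_number_circlepath_centre)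
  moreover have "contour_integral ?c (\<lambda>x. deriv ?F x / ?F x) = contour_integral ?c (\<lambda>w. deriv f w * (1 / (f w - f z)))"
  proof (rule contour_integral_eq)
    fix w assume "w \<in> path_image ?c"
    then have "w \<in> ?B" using im by auto
    then have "f field_differentiable at w"
      using fB holomorphic_on_imp_differentiable_at by blast
    then show "deriv ?F w / ?F w = deriv f w * (1 / (f w - f z))"
      by (simp add: deriv_diff)
  qed
  moreover have an: "f analytic_on ?B" using fB by (simp add: analytic_on_open)
  then have "contour_integral (f \<circ> ?c) (\<lambda>w. 1 / (w - f z)) = contour_integral ?c (\<lambda>w. deriv f w * (1 / (f w - f z)))"
    by (rule contour_integral_comp_analyticW) (use im in auto)
  moreover have "winding_number (f \<circ> ?c) (f z) = 1/(2*pi*\<i>) * contour_integral (f \<circ> ?c) (\<lambda>w. 1/(w - f z))"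
  proof (rule winding_number_valid_path)
    show "valid_path (f \<circ> ?c)"
      using im by (intro valid_path_compose_analytic[OF valid_path_circlepath an]) blast
    show "f z \<notin> path_image (f \<circ> ?c)"
      using im ne unfolding path_image_compose by force
  qed
  ultimately show ?thesis by simp
qed

text \<open>The surface is parametrized from the plane, while \<open>plane_chart\<close> asks for
  maps into the plane. Using \<open>inv_into\<close> makes the chart depend on \<open>p\<close> and
  \<open>W\<close> only, not on the chosen inverse \<open>g\<close>.\<close>

lemma plane_chart_inv_into:
  assumes "open W" "openin (top_of_set X) (p ` W)" "homeomorphism W (p ` W) p g"
  shows "plane_chart (top_of_set X) (p ` W) (inv_into W p)"
proof -
  have inj: "inj_on p W" and g: "\<And>u. u \<in> W \<Longrightarrow> g (p u) = u"
    using assms(3) by (auto simp: homeomorphism_def inj_on_def) metis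
  have sub: "subtopology (top_of_set X) (p ` W) = top_of_set (p ` W)"
    using assms(2) by (metis inf.absorb2 openin_subset subtopology_subtopology topspace_euclidean_subtopology)
  have eq: "inv_into W p ` p ` W = W"
    using inj by (simp add: inv_into_image_cancel)
  have "homeomorphism (p ` W) W (inv_into W p) p"
    using homeomorphism_symD[OF assms(3)]
    by (rule homeomorphism_cong) (auto simp: g inj inv_into_f_f)
  then have "homeomorphic_map (top_of_set (p ` W)) (top_of_set W) (inv_into W p)"
    unfolding homeomorphism_def homeomorphic_map_maps homeomorphic_maps_def by auto
  then show ?thesis
    using assms by (simp add: plane_chart_def sub eq)
qed

text \<open>The functions \<open>\<beta>\<close> play the role of a branched covering by the sphere, written in the
  charts: continuous transition maps that commute with it are holomorphic away from its
  critical points.\<close>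

lemma orientable_of_parametrizations:
  fixes p :: "'i \<Rightarrow> complex \<Rightarrow> 'a::topological_space"
  assumes W: "\<And>i. i \<in> I \<Longrightarrow> open (W i)"
    and op: "\<And>i. i \<in> I \<Longrightarrow> openin (top_of_set X) (p i ` W i)"
    and hom: "\<And>i. i \<in> I \<Longrightarrow> \<exists>g. homeomorphism (W i) (p i ` W i) (p i) g"
    and cover: "X \<subseteq> (\<Union>i\<in>I. p i ` W i)"
    and \<beta>: "\<And>i j u w. \<lbrakk>i \<in> I; j \<in> I; i \<noteq> j; u \<in> W i; w \<in> W j; p i u = p j w\<rbrakk> \<Longrightarrow>
            \<beta> i u = \<beta> j w \<and> (\<exists>D. D \<noteq> 0 \<and> (\<beta> i has_field_derivative D) (at u))"
  shows "orientable (top_of_set X)"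
    and "\<forall>x\<in>X. \<exists>U \<phi>. x \<in> U \<and> plane_chart (top_of_set X) U \<phi>"
proof -
  have chart: "plane_chart (top_of_set X) (p i ` W i) (inv_into (W i) (p i))" if "i \<in> I" for i
    using plane_chart_inv_into W op hom that by metis
  have inj: "inj_on (p i) (W i)" if "i \<in> I" for i
    using hom[OF that] by (auto simp: homeomorphism_def inj_on_def) metis
  have inv: "inv_into (W i) (p i) (p i u) = u" if "i \<in> I" "u \<in> W i" for i u
    using inj that by simp
  have trans: "orientation_preserving_on (inv_into (W i) (p i) ` (p i ` W i \<inter> p j ` W j))
      (inv_into (W j) (p j) \<circ> inv_into (p i ` W i) (inv_into (W i) (p i)))"
    (is "orientation_preserving_on ?V ?f") if ij: "i \<in> I" "j \<in> I" for i j
  proof -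
    obtain g where g: "homeomorphism (W i) (p i ` W i) (p i) g" using hom ij by blast
    obtain h where h: "homeomorphism (W j) (p j ` W j) (p j) h" using hom ij by blast
    have V: "?V = W i \<inter> p i -` (p j ` W j)"
    proof (intro equalityI subsetI)
      fix u assume "u \<in> W i \<inter> p i -` (p j ` W j)"
      then have "u = inv_into (W i) (p i) (p i u)" "p i u \<in> p i ` W i \<inter> p j ` W j"
        using inv ij by auto
      then show "u \<in> ?V" by (rule image_eqI)
    next
      fix u assume "u \<in> ?V"
      then obtain y where y: "y \<in> p i ` W i" "y \<in> p j ` W j" "u = inv_into (W i) (p i) y" by blast
      then have "u \<in> W i" "p i u = y" by (auto simp only: inv_into_into f_inv_into_f)
      with y show "u \<in> W i \<inter> p i -` (p j ` W j)" by simp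
    qed
    have "openin (top_of_set (p i ` W i)) (p i ` W i \<inter> p j ` W j)"
      using op ij openin_imp_subset[OF op[OF ij(1)]]
      by (intro openin_subset_trans[of X _ "p i ` W i"]) auto
    then have "openin (top_of_set (W i)) (W i \<inter> p i -` (p i ` W i \<inter> p j ` W j))"
      using g by (intro continuous_openin_preimage[of _ _ "p i ` W i"]) (auto simp: homeomorphism_def)
    moreover have "W i \<inter> p i -` (p i ` W i \<inter> p j ` W j) = ?V" unfolding V by auto
    ultimately have oV: "open ?V" using W[OF ij(1)] openin_open_trans by metis
    have f: "?f u = inv_into (W j) (p j) (p i u)" if "u \<in> ?V" for u
    proof -
      have "u \<in> W i" using that V by auto
      then have "inv_into (p i ` W i) (inv_into (W i) (p i)) u = p i u"
        by (intro inv_into_f_eq inj_on_inv_into) (auto simp: inv ij inj)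
      then show ?thesis by simp
    qed
    have pf: "?f u \<in> W j" "p j (?f u) = p i u" if "u \<in> ?V" for u
      using that f[OF that] unfolding V by (auto simp: inv_into_into f_inv_into_f)
    have "inj_on ?f ?V"
    proof (rule inj_onI)
      fix u w assume uw: "u \<in> ?V" "w \<in> ?V" "?f u = ?f w"
      then have "p i u = p i w" using pf by metis
      then show "u = w" using uw inj[OF ij(1)] unfolding V by (auto dest: inj_onD)
    qed
    have "continuous_on ?V (\<lambda>u. h (p i u))"
      using g h unfolding V homeomorphism_def
      by (intro continuous_on_compose2[of "p j ` W j" h _ "p i"]) (auto elim: continuous_on_subset)
    moreover have "h (p i u) = ?f u" if "u \<in> ?V" for u
      using pf[OF that] h by (metis homeomorphism_apply1)
    ultimately have cf: "continuous_on ?V ?f" by (rule continuous_on_eq)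
    \<comment> \<open>A chart against itself gives the identity. Hence nothing is asked of
      \<open>\<beta>\<close> where only one chart lives, and this is where its critical points
      are.\<close>
    have "?f holomorphic_on ?V"
    proof (cases "i = j")
      case True
      then have "?f u = u" if "u \<in> ?V" for u
        using f[OF that] that inv ij unfolding V by auto
      then show ?thesis by (metis holomorphic_transform holomorphic_on_ident)
    next
      case False
      show ?thesis unfolding holomorphic_on_open[OF oV]
      proof
        fix u assume u: "u \<in> ?V"
        have b: "\<beta> j (?f w) = \<beta> i w" if "w \<in> ?V" for w
          using \<beta>[OF ij False] pf[OF that] that unfolding V by (metis IntD1)
        have uW: "u \<in> W i" using u V by auto
        obtain D where D: "D \<noteq> 0" "(\<beta> j has_field_derivative D) (at (?f u))"
          using \<beta>[OF ij(2,1) _ pf(1)[OF u] uW] pf[OF u] False by metis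
        obtain D' where D': "(\<beta> i has_field_derivative D') (at u)"
          using \<beta>[OF ij(1,2) False uW pf(1)[OF u]] pf[OF u] by metis
        show "\<exists>f'. (?f has_field_derivative f') (at u)"
          using injective_lift_field_differentiable[OF oV u cf \<open>inj_on ?f ?V\<close> D(2,1) D' b] by blast
      qed
    qed
    then show ?thesis
      unfolding orientation_preserving_on_def
      using winding_number_injective_holomorphic_circle[OF _ oV \<open>inj_on ?f ?V\<close>] by blast
  qed
  have XU: "X = (\<Union>i\<in>I. p i ` W i)"
    using cover openin_imp_subset[OF op] by blast
  show "orientable (top_of_set X)"
    unfolding orientable_def
  proof (intro exI[of _ "(\<lambda>i. (p i ` W i, inv_into (W i) (p i))) ` I"] conjI)
    show "\<forall>(U, \<phi>)\<in>(\<lambda>i. (p i ` W i, inv_into (W i) (p i))) ` I. plane_chart (top_of_set X) U \<phi>"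
      using chart by auto
    show "(\<Union>(U, \<phi>)\<in>(\<lambda>i. (p i ` W i, inv_into (W i) (p i))) ` I. U) = topspace (top_of_set X)"
      using XU by auto
  qed (use trans in \<open>auto simp del: o_apply\<close>)
  show "\<forall>x\<in>X. \<exists>U \<phi>. x \<in> U \<and> plane_chart (top_of_set X) U \<phi>"
  proof
    fix x assume "x \<in> X"
    then obtain i where "i \<in> I" "x \<in> p i ` W i" using cover by blast
    then show "\<exists>U \<phi>. x \<in> U \<and> plane_chart (top_of_set X) U \<phi>" using chart by metis
  qed
qed

section \<open>Two Eulerian circuits of a complete graph\<close>

text \<open>Polymorphic because the same sign acts on the integer steps of the walk, on the real
  coordinates of a disc and on complex powers in a star.\<close>

definition parity_sign :: "bool \<Rightarrow> 'a::ring_1" where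
  "parity_sign s = (if s then 1 else - 1)"

lemma parity_sign_simps [simp]:
  "parity_sign s * (parity_sign s * a) = a" "parity_sign (\<not> s) = - parity_sign s"
  by (auto simp: parity_sign_def)

text \<open>The closed walks \<open>c True\<close> and \<open>c False\<close> bound the two faces. The neighbours of \<open>x\<close>, in the cyclic
  order of the rotation at \<open>x\<close>, are \<open>nb x 0, \<dots>, nb x (2 * m - 1)\<close>. The corner at \<open>x\<close> between \<open>nb x j\<close> and
  \<open>nb x (j + 1)\<close> belongs to \<open>c (even j)\<close>, where it occurs at time \<open>pos x j\<close>.\<close>

locale circuit_pair =
  fixes v m N :: nat
    and c :: "bool \<Rightarrow> int \<Rightarrow> nat"
    and pos :: "nat \<Rightarrow> int \<Rightarrow> int"
    and nb :: "nat \<Rightarrow> int \<Rightarrow> nat"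
  assumes v_eq: "v = 2 * m + 1" and m_pos: "0 < m" and N_pos: "0 < N"
    and c_less: "c s i < v"
    and c_period: "c s (i + int N * n) = c s i"
    and c_Suc_neq: "c s (i + 1) \<noteq> c s i"
    and c_pos: "x < v \<Longrightarrow> c (even j) (pos x j) = x"
    and c_pos_Suc: "x < v \<Longrightarrow> c (even j) (pos x j + 1) = nb x j"
    and c_pos_pred: "x < v \<Longrightarrow> c (even j) (pos x j - 1) = nb x (j + 1)"
    and pos_surj: "c s i = x \<Longrightarrow> \<exists>j n. even j = s \<and> i = pos x j + int N * n"
    and pos_inj: "\<lbrakk>x < v; even i = even j; pos x i = pos x j + int N * n\<rbrakk> \<Longrightarrow> [i = j] (mod (2 * int m))"
    and pos_period: "pos x (j + 2 * int m * n) = pos x j"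
    and nb_inj: "\<lbrakk>x < v; nb x i = nb x j\<rbrakk> \<Longrightarrow> [i = j] (mod (2 * int m))"
    and nb_parity: "\<lbrakk>x < v; nb (nb x i) j = x\<rbrakk> \<Longrightarrow> even i \<noteq> even j"

definition triangular :: "int \<Rightarrow> int" where
  "triangular r = r * (r + 1) div 2"

lemma triangular_Suc: "triangular (r + 1) = triangular r + r + 1"
proof -
  have "(r + 1) * (r + 1 + 1) = r * (r + 1) + (r + 1) * 2" by (simp add: algebra_simps)
  then show ?thesis unfolding triangular_def by (simp only: div_mult_self1)
qed

lemma triangular_double: "2 * triangular r = r * (r + 1)"
  unfolding triangular_def by simp

text \<open>The closed form of the walk with steps \<open>1, 2, \<dots>, m, 1, 2, \<dots>, m, \<dots>\<close>. Its increment over a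
  period is a unit modulo \<open>2 * m + 1\<close>, so modulo that number it closes up only after \<open>2 * m + 1\<close>
  periods.\<close>

definition walk :: "int \<Rightarrow> int \<Rightarrow> int" where
  "walk m i = (i div m) * triangular m + triangular (i mod m)"

lemma walk_Suc:
  assumes "0 < m"
  shows "walk m (i + 1) = walk m i + i mod m + 1"
proof (cases "i mod m = m - 1")
  case True
  then have "i = m * (i div m) + (m - 1)" by (metis mult_div_mod_eq)
  then have i: "i + 1 = m * (i div m + 1)" by (simp add: algebra_simps)
  have "(i + 1) div m = i div m + 1" "(i + 1) mod m = 0"
    using assms by (simp_all add: i)
  moreover have "triangular m = triangular (m - 1) + m" "triangular 0 = 0"
    using triangular_Suc[of "m - 1"] by (simp_all add: triangular_def)
  ultimately show ?thesis
    unfolding walk_def True by (simp add: distrib_right)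
next
  case False
  have "i mod m < m - 1" using False pos_mod_bound[OF assms, of i] by simp
  moreover have "0 \<le> i mod m" using assms by simp
  moreover have "i + 1 = m * (i div m) + (i mod m + 1)" by simp
  ultimately have "(i + 1) div m = i div m" "(i + 1) mod m = i mod m + 1"
    by (smt (verit) div_pos_pos_trivial int_div_pos_eq int_mod_pos_eq)+
  then show ?thesis by (simp add: walk_def triangular_Suc)
qed

text \<open>From \<open>(2 * m + 1)^2 = 8 * triangular m + 1\<close>. So \<open>- 8\<close> is the
  inverse of the increment of one round of the walk.\<close>

lemma triangular_inverse: "[(- 8) * triangular m = 1] (mod (2 * m + 1))"
proof -
  have "(- 8) * triangular m - 1 = - 4 * (m * (m + 1)) - 1"
    using triangular_double[of m] by simp
  also have "\<dots> = (2 * m + 1) * (- (2 * m + 1))" by (simp add: algebra_simps)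
  finally show ?thesis by (metis cong_iff_dvd_diff dvd_triv_left)
qed

lemma walk_period: "0 < m \<Longrightarrow> walk m (i + m * (2 * m + 1) * n) = walk m i + (2 * m + 1) * (n * triangular m)"
proof -
  assume "0 < m"
  then have "(i + m * ((2 * m + 1) * n)) div m = i div m + (2 * m + 1) * n"
    "(i + m * ((2 * m + 1) * n)) mod m = i mod m" by simp_all
  then show ?thesis unfolding walk_def by (simp add: algebra_simps)
qed

text \<open>At equal phases the congruence only compares the numbers of completed rounds, multiplied
  by \<open>triangular m\<close>; multiplication by \<open>- 8\<close> cancels that unit. Hence
  within one full period each residue is met exactly once at each phase.\<close>

lemma walk_cong_imp:
  assumes "0 < m" "i mod m = j mod m" "[walk m i = walk m j] (mod (2 * m + 1))"
  shows "\<exists>n. i = j + m * (2 * m + 1) * n"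
proof -
  have "[i div m * triangular m = j div m * triangular m] (mod (2 * m + 1))"
    using assms(2,3) by (simp add: walk_def cong_iff_dvd_diff)
  then have "[i div m * ((- 8) * triangular m) = j div m * ((- 8) * triangular m)] (mod (2 * m + 1))"
    by (metis cong_scalar_left mult.left_commute)
  moreover have "[k * ((- 8) * triangular m) = k * 1] (mod (2 * m + 1))" for k
    by (intro cong_scalar_left triangular_inverse)
  ultimately have "[i div m = j div m] (mod (2 * m + 1))"
    by (metis cong_sym cong_trans mult.right_neutral)
  then obtain n where n: "i div m - j div m = (2 * m + 1) * n"
    by (auto simp: cong_iff_dvd_diff)
  have "i - j = m * (i div m - j div m)"
  proof -
    have "i - j = (m * (i div m) + i mod m) - (m * (j div m) + j mod m)" by simp
    then show ?thesis unfolding assms(2) by (simp only: right_diff_distrib)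
  qed
  with n show ?thesis by (intro exI[of _ n]) (simp add: algebra_simps)
qed

text \<open>The time of phase \<open>r mod m\<close> at which the walk is at \<open>x\<close>: the
  number \<open>q\<close> of completed rounds must solve
  \<open>q * triangular m = x - triangular (r mod m)\<close> modulo \<open>2 * m + 1\<close>, and
  \<open>- 8\<close> inverts \<open>triangular m\<close>.\<close>

definition walk_position :: "int \<Rightarrow> int \<Rightarrow> int \<Rightarrow> int" where
  "walk_position m x r = m * (- 8 * (x - triangular (r mod m))) + r mod m"

lemma walk_position_mod: "walk_position m x r mod m = r mod m"
  by (simp add: walk_position_def)

lemma walk_walk_position:
  assumes "0 < m"
  shows "[walk m (walk_position m x r) = x] (mod (2 * m + 1))"
proof -
  have "(r mod m) div m = 0" using assms by (simp add: pos_mod_bound pos_mod_sign div_pos_pos_trivial)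
  then have "walk_position m x r div m = - 8 * (x - triangular (r mod m))"
    using assms by (simp add: walk_position_def)
  then have "walk m (walk_position m x r)
      = - 8 * (x - triangular (r mod m)) * triangular m + triangular (r mod m)"
    by (simp only: walk_def walk_position_mod)
  also have "\<dots> = (x - triangular (r mod m)) * ((- 8) * triangular m) + triangular (r mod m)"
    by (simp add: algebra_simps)
  finally have "walk m (walk_position m x r)
      = (x - triangular (r mod m)) * ((- 8) * triangular m) + triangular (r mod m)" .
  moreover have "[(x - triangular (r mod m)) * ((- 8) * triangular m) + triangular (r mod m)
      = (x - triangular (r mod m)) * 1 + triangular (r mod m)] (mod (2 * m + 1))"
    by (intro cong_add cong_refl cong_scalar_left triangular_inverse)
  ultimately show ?thesis by simp
qed

definition label :: "nat \<Rightarrow> bool \<Rightarrow> int \<Rightarrow> nat" where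
  "label m s i = nat (parity_sign s * walk (int m) i mod (2 * int m + 1))"

text \<open>For odd \<open>j\<close> the circuit is the negated walk, so the walk has to hit
  \<open>- x\<close>. The phase \<open>- j\<close> makes the leaving step drop by one from each
  corner to the next, hence by two between consecutive corners of the same circuit.\<close>

definition corner :: "nat \<Rightarrow> nat \<Rightarrow> int \<Rightarrow> int" where
  "corner m x j = walk_position (int m) (parity_sign (even j) * int x) (- j)"

definition neighbour :: "nat \<Rightarrow> nat \<Rightarrow> int \<Rightarrow> nat" where
  "neighbour m x j = nat ((int x + parity_sign (even j) * (1 + (- j) mod int m)) mod (2 * int m + 1))"

lemma label_cong: "[int (label m s i) = parity_sign s * walk (int m) i] (mod (2 * int m + 1))"
  by (simp add: label_def cong_def)

lemma neighbour_cong: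
  "[int (neighbour m x j) = int x + parity_sign (even j) * (1 + (- j) mod int m)] (mod (2 * int m + 1))"
  by (simp add: neighbour_def cong_def)

lemma label_less: "label m s i < 2 * m + 1"
  using pos_mod_bound[of "2 * int m + 1" "parity_sign s * walk (int m) i"]
  by (simp add: label_def nat_less_iff)

lemma neighbour_less: "neighbour m x i < 2 * m + 1"
  using pos_mod_bound[of "2 * int m + 1" "int x + parity_sign (even i) * (1 + (- i) mod int m)"]
  by (simp add: neighbour_def nat_less_iff)

lemma int_cong_less_imp_eq:
  assumes "[int x = int y] (mod (2 * int m + 1))" "x < 2 * m + 1" "y < 2 * m + 1"
  shows "x = y"
  using assms by (simp add: cong_def)

lemma label_Suc:
  assumes "0 < m"
  shows "[int (label m s (i + 1)) = int (label m s i) + parity_sign s * (1 + i mod int m)] (mod (2 * int m + 1))"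
proof -
  have "[parity_sign s * walk (int m) (i + 1) = parity_sign s * walk (int m) i + parity_sign s * (1 + i mod int m)]
      (mod (2 * int m + 1))"
  proof -
    have "parity_sign s * walk (int m) (i + 1) = parity_sign s * walk (int m) i + parity_sign s * (1 + i mod int m)"
      using walk_Suc[of "int m" i] assms by (simp add: algebra_simps)
    then show ?thesis by simp
  qed
  then show ?thesis
    using label_cong[of m s "i + 1"] label_cong[of m s i] by (meson cong_add_rcancel cong_sym cong_trans)
qed

lemma small_step_not_cong:
  assumes "0 < a" "a < 2 * int m + 1"
  shows "\<not> [x + parity_sign s * a = x] (mod (2 * int m + 1))"
  using assms zdvd_imp_le[of "2 * int m + 1" a] by (auto simp: cong_iff_dvd_diff parity_sign_def)

lemma step_bounds: "0 < m \<Longrightarrow> 0 < 1 + i mod int m \<and> 1 + i mod int m \<le> int m"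
  using pos_mod_bound[of "int m" i] pos_mod_sign[of "int m" i] by linarith

lemma label_corner:
  assumes "0 < m" "x < 2 * m + 1"
  shows "label m (even j) (corner m x j) = x"
proof (rule int_cong_less_imp_eq[OF _ label_less assms(2)])
  have "[parity_sign (even j) * walk (int m) (corner m x j) = parity_sign (even j) * (parity_sign (even j) * int x)]
      (mod (2 * int m + 1))"
    unfolding corner_def using assms by (intro cong_scalar_left walk_walk_position) simp
  then show "[int (label m (even j) (corner m x j)) = int x] (mod (2 * int m + 1))"
    using label_cong cong_trans by simp blast
qed

lemma corner_mod: "corner m x j mod int m = (- j) mod int m"
  by (simp add: corner_def walk_position_mod)

text \<open>A corner index is seen through its parity, which selects the circuit, and through its
  phase modulo \<open>m\<close>. As \<open>m\<close> is odd, the two together determine it modulo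
  \<open>2 * m\<close> and can be prescribed independently.\<close>

lemma circuit_pair_complete_graph:
  assumes "odd m"
  shows "circuit_pair (2 * m + 1) m (m * (2 * m + 1)) (label m) (corner m) (neighbour m)"
proof
  show "2 * m + 1 = 2 * m + 1" ..
  show m: "0 < m" using assms by (auto elim: oddE)
  then show "0 < m * (2 * m + 1)" by simp
  have coprime: "coprime 2 (int m)" using assms by simp
  have mod_double: "[i = j] (mod (2 * int m))" if "even i = even j" "(- i) mod int m = (- j) mod int m" for i j
  proof -
    have "int m dvd i - j" using that(2) by (metis cong_def cong_iff_dvd_diff cong_minus_minus_iff)
    moreover have "2 dvd i - j" using that(1) by simp
    ultimately show ?thesis using coprime by (metis cong_iff_dvd_diff divides_mult)
  qed
  have N: "int (m * (2 * m + 1)) = int m * (2 * int m + 1)" by (simp add: algebra_simps)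
  fix s x y i j n
  show "label m s i < 2 * m + 1" by (rule label_less)
  show "label m s (i + int (m * (2 * m + 1)) * n) = label m s i"
  proof (rule int_cong_less_imp_eq[OF _ label_less label_less])
    have "[parity_sign s * walk (int m) (i + int (m * (2 * m + 1)) * n) = parity_sign s * walk (int m) i] (mod (2 * int m + 1))"
    proof (rule cong_scalar_left)
      show "[walk (int m) (i + int (m * (2 * m + 1)) * n) = walk (int m) i] (mod (2 * int m + 1))"
        unfolding N using walk_period[of "int m" i n] m by (simp only: cong_iff_dvd_diff) simp
    qed
    then show "[int (label m s (i + int (m * (2 * m + 1)) * n)) = int (label m s i)] (mod (2 * int m + 1))"
      using label_cong by (meson cong_sym cong_trans)
  qed
  show "label m s (i + 1) \<noteq> label m s i"
    using label_Suc[OF m, of s i] small_step_not_cong[of "1 + i mod int m" m "int (label m s i)" s] step_bounds[OF m, of i]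
    by (auto dest: cong_sym)
  show "label m (even j) (corner m x j) = x" if "x < 2 * m + 1"
    using label_corner[OF m that] .
  show "label m (even j) (corner m x j + 1) = neighbour m x j" if "x < 2 * m + 1"
    using label_Suc[OF m, of "even j" "corner m x j"] neighbour_cong[of m x j]
    by (intro int_cong_less_imp_eq[OF _ label_less neighbour_less])
       (simp add: label_corner[OF m that] corner_mod, meson cong_sym cong_trans)
  show "label m (even j) (corner m x j - 1) = neighbour m x (j + 1)" if "x < 2 * m + 1"
  proof (rule int_cong_less_imp_eq[OF _ label_less neighbour_less])
    \<comment> \<open>The step entering \<open>x\<close> has the phase of corner
      \<open>j + 1\<close>. Going back along it flips the sign, which is the change of parity from
      \<open>j\<close> to \<open>j + 1\<close>.\<close>
    have "(corner m x j - 1) mod int m = (- (j + 1)) mod int m"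
      using corner_mod[of m x j] by (metis add.inverse_distrib_swap add_uminus_conv_diff mod_diff_left_eq uminus_add_conv_diff)
    then have "[int x = int (label m (even j) (corner m x j - 1)) + parity_sign (even j) * (1 + (- (j + 1)) mod int m)]
        (mod (2 * int m + 1))"
      using label_Suc[OF m, of "even j" "corner m x j - 1"] by (simp add: label_corner[OF m that])
    then have "[int (label m (even j) (corner m x j - 1)) = int x + parity_sign (even (j + 1)) * (1 + (- (j + 1)) mod int m)]
        (mod (2 * int m + 1))"
      by (simp add: cong_iff_dvd_diff dvd_diff_commute algebra_simps)
    then show "[int (label m (even j) (corner m x j - 1)) = int (neighbour m x (j + 1))] (mod (2 * int m + 1))"
      using neighbour_cong[of m x "j + 1"] by (meson cong_sym cong_trans)
  qed
  show "\<exists>j n. even j = s \<and> i = corner m x j + int (m * (2 * m + 1)) * n" if "label m s i = x"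
  proof -
    \<comment> \<open>Both candidates have the phase of \<open>i\<close>; since \<open>m\<close> is
      odd, one of them has the wanted parity.\<close>
    define j where "j = (if even (- i) = s then - i else - i + int m)"
    have j: "even j = s" "(- j) mod int m = i mod int m"
      using assms by (auto simp: j_def)
    have "x < 2 * m + 1" using that label_less by blast
    then have "label m s (corner m x j) = label m s i"
      using label_corner[OF m, of x j] that j by simp
    then have "[parity_sign s * walk (int m) i = parity_sign s * walk (int m) (corner m x j)] (mod (2 * int m + 1))"
      using label_cong[of m s i] label_cong[of m s "corner m x j"] cong_trans[OF cong_sym] by metis
    then have "[parity_sign s * (parity_sign s * walk (int m) i) = parity_sign s * (parity_sign s * walk (int m) (corner m x j))]
        (mod (2 * int m + 1))"
      by (rule cong_scalar_left)
    then have "[walk (int m) i = walk (int m) (corner m x j)] (mod (2 * int m + 1))" by simp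
    then have "\<exists>n. i = corner m x j + int m * (2 * int m + 1) * n"
      using walk_cong_imp[of "int m" i "corner m x j"] m j corner_mod[of m x j] by simp
    then show ?thesis unfolding N using j(1) by blast
  qed
  show "[i = j] (mod (2 * int m))"
    if "x < 2 * m + 1" "even i = even j" "corner m x i = corner m x j + int (m * (2 * m + 1)) * n"
  proof (rule mod_double[OF that(2)])
    have "corner m x i mod int m = corner m x j mod int m"
      unfolding that(3) N by (simp only: mult.assoc mod_mult_self2)
    then show "(- i) mod int m = (- j) mod int m" by (simp add: corner_mod)
  qed
  have mp: "(- (j + 2 * int m * n)) mod int m = (- j) mod int m"
  proof -
    have "- (j + 2 * int m * n) = - j + int m * (- 2 * n)" by (simp add: algebra_simps)
    then show ?thesis by (simp only: mod_mult_self2)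
  qed
  show "corner m x (j + 2 * int m * n) = corner m x j"
    using mp by (simp add: corner_def walk_position_def)
  show "[i = j] (mod (2 * int m))" if "x < 2 * m + 1" "neighbour m x i = neighbour m x j"
  proof -
    let ?a = "1 + (- i) mod int m" and ?b = "1 + (- j) mod int m"
    have d: "2 * int m + 1 dvd parity_sign (even i) * ?a - parity_sign (even j) * ?b"
    proof -
      have "[int x + parity_sign (even i) * ?a = int (neighbour m x j)] (mod (2 * int m + 1))"
        using cong_sym[OF neighbour_cong[of m x i]] unfolding that(2) .
      then have "[int x + parity_sign (even i) * ?a = int x + parity_sign (even j) * ?b] (mod (2 * int m + 1))"
        using neighbour_cong[of m x j] by (rule cong_trans)
      then show ?thesis by (simp add: cong_iff_dvd_diff)
    qed
    have ab: "0 < ?a" "?a \<le> int m" "0 < ?b" "?b \<le> int m" using step_bounds[OF m] by auto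
    show ?thesis
    proof (cases "even i = even j")
      case True
      then have "2 * int m + 1 dvd ?a - ?b"
        using d by (auto simp: parity_sign_def dvd_diff_commute split: if_splits)
      have "?a = ?b"
      proof (rule ccontr)
        assume "?a \<noteq> ?b"
        then have "2 * int m + 1 \<le> \<bar>?a - ?b\<bar>"
          using \<open>2 * int m + 1 dvd ?a - ?b\<close> by (intro zdvd_imp_le) (simp_all only: dvd_abs_iff zero_less_abs_iff right_minus_eq not_False_eq_True)
        then show False using ab by linarith
      qed
      then show ?thesis using mod_double True by simp
    next
      \<comment> \<open>Opposite signs would make the sum of two steps divisible by
        \<open>2 * m + 1\<close>, but it is positive and at most \<open>2 * m\<close>.\<close>
      case False
      then have "2 * int m + 1 dvd ?a + ?b \<or> 2 * int m + 1 dvd - (?a + ?b)"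
        using d by (auto simp: parity_sign_def split: if_splits)
      then have "2 * int m + 1 dvd ?a + ?b" by (metis dvd_minus_iff)
      then show ?thesis using ab zdvd_imp_le[of "2 * int m + 1" "?a + ?b"] by linarith
    qed
  qed
  show "even i \<noteq> even j" if "x < 2 * m + 1" "neighbour m (neighbour m x i) j = x"
  proof
    let ?a = "1 + (- i) mod int m" and ?b = "1 + (- j) mod int m"
    \<comment> \<open>With equal signs the way to the neighbour and back would be a net move by
      \<open>?a + ?b\<close>, again too short to be zero modulo \<open>2 * m + 1\<close>.\<close>
    assume e: "even i = even j"
    have "[int (neighbour m x i) + parity_sign (even i) * ?b = int x + parity_sign (even i) * ?a + parity_sign (even i) * ?b]
        (mod (2 * int m + 1))"
      using neighbour_cong[of m x i] by (intro cong_add cong_refl)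
    moreover have "[int x = int (neighbour m x i) + parity_sign (even i) * ?b] (mod (2 * int m + 1))"
      using neighbour_cong[of m "neighbour m x i" j] that(2) e by simp
    ultimately have "[int x + parity_sign (even i) * (?a + ?b) = int x] (mod (2 * int m + 1))"
      using cong_trans cong_sym by (simp only: distrib_left add.assoc) blast
    moreover have "0 < ?a + ?b" "?a + ?b < 2 * int m + 1"
      using step_bounds[OF m, of "- i"] step_bounds[OF m, of "- j"] by auto
    ultimately show False using small_step_not_cong by blast
  qed
qed

section \<open>The surface\<close>

definition trail :: "(int \<Rightarrow> nat) \<Rightarrow> real \<Rightarrow> nat \<Rightarrow> real" where
  "trail c \<tau> = edge_point (c \<lfloor>\<tau>\<rfloor>) (c (\<lfloor>\<tau>\<rfloor> + 1)) (frac \<tau>)"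

lemma edge_point_0: "edge_point x y 0 = edge_point x z 0"
  by (auto simp: edge_point_def)

lemma edge_point_1: "edge_point x y 1 = edge_point y z 0"
  by (auto simp: edge_point_def)

lemma edge_point_swap: "edge_point x y t = edge_point y x (1 - t)"
  by (auto simp: edge_point_def)

lemma edge_point_fst: "y \<noteq> x \<Longrightarrow> edge_point x y t x = 1 - t"
  by (simp add: edge_point_def)

lemma edge_point_eqD_same:
  assumes "edge_point x y a = edge_point x z b" "y \<noteq> x" "z \<noteq> x"
  shows "a = b" "a = 0 \<or> y = z"
proof -
  show "a = b" using fun_cong[OF assms(1), of x] assms(2,3) by (simp add: edge_point_fst)
  then show "a = 0 \<or> y = z"
    using fun_cong[OF assms(1), of y] assms(2) by (auto simp: edge_point_def of_bool_def split: if_splits)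
qed

lemma edge_point_eqD_distinct:
  assumes "edge_point x x' a = edge_point y y' b" "x' \<noteq> x" "y' \<noteq> y" "x \<noteq> y" "a < 1" "b < 1"
  shows "x' = y" "y' = x" "a = 1 - b"
proof -
  show "x' = y" using fun_cong[OF assms(1), of y] assms by (auto simp: edge_point_def of_bool_def split: if_splits)
  show "y' = x" using fun_cong[OF assms(1), of x] assms by (auto simp: edge_point_def of_bool_def split: if_splits)
  with fun_cong[OF assms(1), of x] assms show "a = 1 - b" by (auto simp: edge_point_def of_bool_def)
qed

text \<open>The right end point is included: the floor has moved on there, but both formulas give
  the vertex \<open>c (i + 1)\<close>. So the pieces can be glued, and time can also be measured
  backwards from a corner.\<close>

lemma trail_eq:
  assumes "of_int i \<le> \<tau>" "\<tau> \<le> of_int i + 1"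
  shows "trail c \<tau> = edge_point (c i) (c (i + 1)) (\<tau> - of_int i)"
proof (cases "\<tau> = of_int i + 1")
  case True
  then have "\<lfloor>\<tau>\<rfloor> = i + 1" "frac \<tau> = 0" by (simp_all add: frac_def)
  with True show ?thesis
    using edge_point_1[of "c i" "c (i + 1)" "c (2 + i)"] by (simp add: trail_def)
next
  case False
  then have "\<lfloor>\<tau>\<rfloor> = i" using assms by (simp add: floor_eq_iff)
  then show ?thesis by (simp add: trail_def frac_def)
qed

lemma continuous_on_trail: "continuous_on {0..real n} (trail c)"
proof (induction n)
  case 0
  then show ?case by simp
next
  case (Suc n)
  have "continuous_on {real n..real (Suc n)} (\<lambda>\<tau>. edge_point (c (int n)) (c (int n + 1)) (\<tau> - of_int (int n)))"
    unfolding edge_point_def by (intro continuous_on_coordinatewise_then_product continuous_intros)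
  then have "continuous_on {real n..real (Suc n)} (trail c)"
    by (rule continuous_on_eq) (simp add: trail_eq[of "int n"])
  with Suc.IH have "continuous_on ({0..real n} \<union> {real n..real (Suc n)}) (trail c)"
    by (intro continuous_on_closed_Un) auto
  then show ?case by (simp add: ivl_disj_un_two_touch)
qed

text \<open>A positive coordinate at \<open>x\<close> means that the current edge is incident with
  \<open>x\<close>; the visit of \<open>x\<close> at the matching end of that edge is then as far
  away in time as the coordinate falls short of 1.\<close>

lemma trail_pos_imp_near:
  assumes "0 < trail c \<tau> x" and ne: "\<And>i. c (i + 1) \<noteq> c i"
  obtains i where "c i = x" "\<bar>\<tau> - of_int i\<bar> = 1 - trail c \<tau> x"
proof -
  have "c \<lfloor>\<tau>\<rfloor> = x \<or> c (\<lfloor>\<tau>\<rfloor> + 1) = x"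
    using assms(1) by (auto simp: trail_def edge_point_def of_bool_def split: if_splits)
  then show thesis
  proof
    assume x: "c \<lfloor>\<tau>\<rfloor> = x"
    then have "trail c \<tau> x = 1 - frac \<tau>"
      using ne[of "\<lfloor>\<tau>\<rfloor>"] by (auto simp: trail_def edge_point_def)
    then show thesis using x that[of "\<lfloor>\<tau>\<rfloor>"] by (simp add: frac_def)
  next
    assume x: "c (\<lfloor>\<tau>\<rfloor> + 1) = x"
    then have "trail c \<tau> x = frac \<tau>"
      using ne[of "\<lfloor>\<tau>\<rfloor>"] by (auto simp: trail_def edge_point_def)
    then show thesis using x that[of "\<lfloor>\<tau>\<rfloor> + 1"] frac_lt_1[of \<tau>] by (simp add: frac_def abs_if)
  qed
qed

section \<open>The two discs as cones over the circuits\<close>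

context circuit_pair
begin

lemma trail_period: "trail (c s) (\<tau> + real N * of_int n) = trail (c s) \<tau>"
proof -
  have "\<tau> + real N * of_int n = \<tau> + of_int (int N * n)" by simp
  moreover have "\<lfloor>\<tau> + of_int (int N * n)\<rfloor> = \<lfloor>\<tau>\<rfloor> + int N * n" "frac (\<tau> + of_int (int N * n)) = frac \<tau>"
    by (simp_all only: frac_def floor_add_int of_int_add) simp
  moreover have "c s (\<lfloor>\<tau>\<rfloor> + int N * n + 1) = c s (\<lfloor>\<tau>\<rfloor> + 1)"
    using c_period[of s "\<lfloor>\<tau>\<rfloor> + 1" n] by (simp add: algebra_simps)
  ultimately show ?thesis by (simp only: trail_def c_period)
qed

lemma trail_eq_0: "v \<le> w \<Longrightarrow> trail (c s) \<tau> w = 0"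
  using c_less[of s "\<lfloor>\<tau>\<rfloor>"] c_less[of s "\<lfloor>\<tau>\<rfloor> + 1"] by (simp add: trail_def edge_point_def)

text \<open>The factor \<open>1 - \<rho>\<close> makes the last three coordinates vanish on the boundary circle, while the
  sign in coordinate \<open>v\<close> separates the two discs.\<close>

definition polar_point :: "bool \<Rightarrow> real \<Rightarrow> real \<Rightarrow> complex \<Rightarrow> nat \<Rightarrow> real" where
  "polar_point s \<rho> \<tau> z = (\<lambda>w. \<rho> * trail (c s) \<tau> w +
     parity_sign s * (1 - \<rho>) * (if w = v then 1 else if w = v + 1 then Re z else if w = v + 2 then Im z else 0))"

definition disc_point :: "bool \<Rightarrow> complex \<Rightarrow> nat \<Rightarrow> real" where
  "disc_point s z = polar_point s (norm z) (real N * Arg2pi z / (2 * pi)) z"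

abbreviation angle :: "real \<Rightarrow> complex" where
  "angle \<tau> \<equiv> cis (2 * pi * \<tau> / real N)"

text \<open>\<open>Arg2pi\<close> jumps, but it enters only through the trail, which has period
  \<open>N\<close>; so any argument may replace it. At the centre the trail has the factor
  0.\<close>

lemma disc_point_polar:
  assumes "0 \<le> \<rho>"
  shows "disc_point s (of_real \<rho> * angle \<tau>) = polar_point s \<rho> \<tau> (of_real \<rho> * angle \<tau>)"
proof (cases "\<rho> = 0")
  case True
  then show ?thesis by (simp add: disc_point_def polar_point_def)
next
  case False
  let ?z = "of_real \<rho> * angle \<tau>"
  have n: "norm ?z = \<rho>" using assms by (simp add: norm_mult)
  have "?z = of_real \<rho> * cis (Arg2pi ?z)"
    using Arg2pi_eq[of ?z] n by (simp add: cis_conv_exp)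
  then have "cis (2 * pi * \<tau> / real N) = cis (Arg2pi ?z)" using False by simp
  then obtain k :: int where "2 * pi * \<tau> / real N = Arg2pi ?z + 2 * pi * of_int k"
    using sin_cos_eq_iff[of "2 * pi * \<tau> / real N" "Arg2pi ?z"] by (auto simp: complex_eq_iff)
  then have "\<tau> = real N * Arg2pi ?z / (2 * pi) + real N * of_int k"
    using N_pos by (simp add: field_simps)
  then have "trail (c s) \<tau> = trail (c s) (real N * Arg2pi ?z / (2 * pi))"
    using trail_period by metis
  then show ?thesis unfolding disc_point_def polar_point_def n by simp
qed

lemma disc_point_angle: "disc_point s (angle \<tau>) = trail (c s) \<tau>"
  using disc_point_polar[of 1 s \<tau>] by (simp add: polar_point_def)

lemma sphere_angle:
  assumes "norm z = 1"
  shows "\<exists>\<tau>. 0 \<le> \<tau> \<and> \<tau> \<le> real N \<and> z = angle \<tau>"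
proof (intro exI conjI)
  let ?\<tau> = "real N * Arg2pi z / (2 * pi)"
  show "0 \<le> ?\<tau>" using Arg2pi_ge_0[of z] by simp
  have "real N * (Arg2pi z / (2 * pi)) \<le> real N"
    using Arg2pi_lt_2pi[of z] Arg2pi_ge_0[of z] by (intro mult_left_le) simp_all
  then show "?\<tau> \<le> real N" by simp
  have "2 * pi * ?\<tau> / real N = Arg2pi z" using N_pos by simp
  then show "z = angle ?\<tau>" using Arg2pi_eq[of z] assms by (simp only: cis_conv_exp) simp
qed

text \<open>In polar coordinates the formula is continuous on a compact rectangle, and the polar map
  from the rectangle covers the disc. Descending along it handles the cut of the argument and the
  centre at once.\<close>

lemma continuous_on_disc_point: "continuous_on (cball 0 1) (disc_point s)"
proof -
  let ?K = "{0..1::real} \<times> {0..real N}"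
  let ?f = "\<lambda>p. of_real (fst p) * angle (snd p)"
  have f: "continuous_on ?K ?f"
    unfolding cis_conv_exp by (intro continuous_intros) (simp add: N_pos)
  have tr: "continuous_on ?K (\<lambda>p. trail (c s) (snd p) w)" for w
    by (rule continuous_on_product_then_coordinatewise)
       (rule continuous_on_compose2[OF continuous_on_trail], auto intro: continuous_intros)
  have "continuous_on ?K (\<lambda>p. polar_point s (fst p) (snd p) (?f p))"
    unfolding polar_point_def
  proof (intro continuous_on_coordinatewise_then_product continuous_intros tr)
    fix w
    show "continuous_on ?K (\<lambda>p. if w = v then 1 else if w = v + 1 then Re (?f p)
        else if w = v + 2 then Im (?f p) else 0)"
      using continuous_on_Re[OF f] continuous_on_Im[OF f] by (cases "w = v"; cases "w = v + 1"; cases "w = v + 2") simp_all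
  qed
  then have "continuous_on ?K (disc_point s \<circ> ?f)"
    by (rule continuous_on_eq) (simp add: disc_point_polar mem_Times_iff)
  then have "continuous_on (?f ` ?K) (disc_point s)"
    using f by (intro continuous_on_compact_quotient compact_Times compact_Icc)
  moreover have "cball 0 1 \<subseteq> ?f ` ?K"
  proof
    fix z :: complex assume z: "z \<in> cball 0 1"
    show "z \<in> ?f ` ?K"
    proof (cases "z = 0")
      case True
      then show ?thesis by (intro image_eqI[of _ _ "(0, 0)"]) simp_all
    next
      case False
      then obtain \<tau> where "0 \<le> \<tau>" "\<tau> \<le> real N" "sgn z = angle \<tau>"
        using sphere_angle[of "sgn z"] norm_sgn[of z] by (metis (full_types))
      moreover have "z = of_real (norm z) * sgn z" using False by (simp add: sgn_div_norm scaleR_conv_of_real)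
      ultimately have "z = ?f (norm z, \<tau>)" "(norm z, \<tau>) \<in> ?K" using z by simp_all
      then show ?thesis by (rule image_eqI)
    qed
  qed
  ultimately show ?thesis using continuous_on_subset by blast
qed

lemma disc_point_v:
  "disc_point s z v = parity_sign s * (1 - norm z)"
  "disc_point s z (Suc v) = parity_sign s * (1 - norm z) * Re z"
  "disc_point s z (Suc (Suc v)) = parity_sign s * (1 - norm z) * Im z"
  by (simp_all add: disc_point_def polar_point_def trail_eq_0)

text \<open>Coordinate \<open>v\<close> yields the disc and the radius, and then its nonzero factor
  can be cancelled in the next two. One of the points may lie on the boundary circle, so interior
  points are separated from the graph too.\<close>

lemma disc_point_inj:
  assumes "disc_point s z = disc_point s' z'" "norm z < 1" "norm z' \<le> 1"
  shows "s = s'" "z = z'"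
proof -
  have "parity_sign s * (1 - norm z) = parity_sign s' * (1 - norm z')"
    using fun_cong[OF assms(1), of v] by (simp add: disc_point_v)
  then show s: "s = s'" using assms(2,3) by (auto simp: parity_sign_def split: if_splits)
  with \<open>parity_sign s * (1 - norm z) = _\<close> have "norm z = norm z'" by (auto simp: parity_sign_def split: if_splits)
  then show "z = z'"
    using fun_cong[OF assms(1), of "Suc v"] fun_cong[OF assms(1), of "Suc (Suc v)"] s assms(2)
    by (auto simp only: disc_point_v complex_eq_iff) (auto simp: parity_sign_def split: if_splits)
qed

definition surf :: "(nat \<Rightarrow> real) set" where
  "surf = (\<Union>s. disc_point s ` cball 0 1)"

definition face :: "bool \<Rightarrow> (nat \<Rightarrow> real) set" where
  "face s = disc_point s ` ball 0 1"

lemma compact_surf: "compact surf"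
  unfolding surf_def by (intro compact_UN compact_continuous_image continuous_on_disc_point) auto

lemma face_eq: "face s = surf \<inter> {y. 0 < parity_sign s * y v}"
proof -
  have "disc_point s' z \<in> face s" if "norm z \<le> 1" "0 < parity_sign s * disc_point s' z v" for s' z
  proof -
    have "s' = s" "norm z < 1" using that by (auto simp: disc_point_v parity_sign_def split: if_splits)
    then show ?thesis by (auto simp: face_def)
  qed
  moreover have "0 < parity_sign s * disc_point s z v" if "norm z < 1" for z
    using that by (auto simp: disc_point_v parity_sign_def)
  moreover have "face s \<subseteq> disc_point s ` cball 0 1" by (simp add: face_def image_mono)
  ultimately show ?thesis by (fastforce simp: face_def surf_def)
qed

lemma openin_face: "openin (top_of_set surf) (face s)"
  unfolding face_eq by (intro openin_open_Int open_Collect_less continuous_intros) auto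

text \<open>The common factor of the last three coordinates, sign included, cancels in the
  quotients; hence a single continuous inverse serves both discs.\<close>

definition face_coordinate :: "(nat \<Rightarrow> real) \<Rightarrow> complex" where
  "face_coordinate y = Complex (y (Suc v) / y v) (y (Suc (Suc v)) / y v)"

lemma face_coordinate: "norm z < 1 \<Longrightarrow> face_coordinate (disc_point s z) = z"
  by (auto simp: face_coordinate_def disc_point_v parity_sign_def complex_eq_iff)

lemma homeomorphism_face: "homeomorphism (ball 0 1) (face s) (disc_point s) face_coordinate"
proof (rule homeomorphismI)
  show "continuous_on (ball 0 1) (disc_point s)"
    using continuous_on_disc_point ball_subset_cball continuous_on_subset by blast
  have "y v \<noteq> 0" if "y \<in> face s" for y
    using that by (auto simp: face_eq)
  then show "continuous_on (face s) face_coordinate"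
    unfolding face_coordinate_def Complex_eq
    by (intro continuous_intros) (auto intro: continuous_on_product_then_coordinatewise continuous_on_id)
qed (auto simp: face_def face_coordinate)

section \<open>The upper half plane over the punctured discs\<close>

definition expN :: "complex \<Rightarrow> complex" where
  "expN t = exp (2 * of_real pi * \<i> * t / of_nat N)"

text \<open>In this coordinate the boundary is the real axis carrying the time of the circuit, and
  all corners look alike: half discs of the same radius about the integers
  \<open>pos x j\<close>.\<close>

definition half_plane_point :: "bool \<Rightarrow> complex \<Rightarrow> nat \<Rightarrow> real" where
  "half_plane_point s t = disc_point s (expN t)"

lemma norm_expN: "norm (expN t) = exp (- 2 * pi * Im t / N)"
  by (simp add: expN_def)

lemma norm_expN_less: "norm (expN t) < 1 \<longleftrightarrow> 0 < Im t" and norm_expN_le: "norm (expN t) \<le> 1 \<longleftrightarrow> 0 \<le> Im t"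
proof -
  define q where "q = 2 * pi / real N"
  have "0 < q" using N_pos by (simp add: q_def)
  moreover have "norm (expN t) = exp (- (q * Im t))" by (simp add: norm_expN q_def)
  ultimately show "norm (expN t) < 1 \<longleftrightarrow> 0 < Im t" "norm (expN t) \<le> 1 \<longleftrightarrow> 0 \<le> Im t"
    by (auto simp: zero_less_mult_iff zero_le_mult_iff)
qed

lemma expN_of_real: "expN (of_real \<tau>) = angle \<tau>"
  by (simp add: expN_def cis_conv_exp mult_ac)

lemma expN_eq_iff: "expN t = expN t' \<longleftrightarrow> (\<exists>n. t = t' + of_int (int N * n))"
proof -
  have "expN t = expN t' \<longleftrightarrow> (\<exists>n::int. 2 * of_real pi * \<i> * t / of_nat N = 2 * of_real pi * \<i> * t' / of_nat N + of_int (2 * n) * of_real pi * \<i>)"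
    unfolding expN_def exp_eq by simp
  also have "\<dots> \<longleftrightarrow> (\<exists>n. t = t' + of_int (int N * n))"
  proof (intro ex_cong1)
    fix n :: int
    have "2 * of_real pi * \<i> * t / of_nat N = 2 * of_real pi * \<i> * t' / of_nat N + of_int (2 * n) * of_real pi * \<i>
      \<longleftrightarrow> 2 * of_real pi * \<i> * t = 2 * of_real pi * \<i> * (t' + of_int (int N * n))"
      using N_pos by (simp add: field_simps)
    then show "(2 * of_real pi * \<i> * t / of_nat N = 2 * of_real pi * \<i> * t' / of_nat N + of_int (2 * n) * of_real pi * \<i>)
      = (t = t' + of_int (int N * n))" by simp
  qed
  finally show ?thesis .
qed

lemma expN_period: "expN (t + of_int (int N * n)) = expN t"
  using expN_eq_iff by blast

lemma expN_power: "expN t ^ N = exp (2 * of_real pi * \<i> * t)"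
proof -
  have "expN t ^ N = exp (of_nat N * (2 * of_real pi * \<i> * t / of_nat N))"
    by (simp only: expN_def exp_of_nat_mult)
  then show ?thesis using N_pos by simp
qed

lemma half_plane_point_of_real: "half_plane_point s (of_real \<tau>) = trail (c s) \<tau>"
  by (simp add: half_plane_point_def expN_of_real disc_point_angle)

lemma half_plane_point_eqD:
  assumes "half_plane_point s t = half_plane_point s' t'" "0 < Im t" "0 \<le> Im t'"
  shows "s = s'" "\<exists>n. t = t' + of_int (int N * n)"
  using disc_point_inj[of s "expN t" s' "expN t'"] assms
  by (auto simp: half_plane_point_def norm_expN_less norm_expN_le expN_eq_iff)

lemma continuous_on_half_plane_point:
  "continuous_on {t. 0 \<le> Im t} (half_plane_point s)"
  unfolding half_plane_point_def
proof (rule continuous_on_compose2[OF continuous_on_disc_point])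
  show "continuous_on {t. 0 \<le> Im t} expN"
    unfolding expN_def using N_pos by (intro continuous_intros) simp
qed (auto simp: norm_expN_le)

lemma nb_neq: "x < v \<Longrightarrow> nb x j \<noteq> x"
  using c_pos[of x j] c_pos_Suc[of x j] c_Suc_neq[of "even j" "pos x j"] by simp

text \<open>The left boundary ray of corner \<open>j\<close> and the right boundary ray of corner
  \<open>j + 1\<close> are the same edge, which is how consecutive half discs around
  \<open>x\<close> fit together.\<close>

lemma half_plane_point_ray:
  assumes "x < v" "0 \<le> e" "e \<le> 1"
  shows "half_plane_point (even j) (of_int (pos x j) + of_real e) = edge_point x (nb x j) e"
    and "half_plane_point (even j) (of_int (pos x j) - of_real e) = edge_point x (nb x (j + 1)) e"
proof -
  have "half_plane_point (even j) (of_real (of_int (pos x j) + e)) = edge_point x (nb x j) e"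
    unfolding half_plane_point_of_real
    using assms by (subst trail_eq[of "pos x j"]) (auto simp: c_pos c_pos_Suc)
  then show "half_plane_point (even j) (of_int (pos x j) + of_real e) = edge_point x (nb x j) e" by simp
  have "half_plane_point (even j) (of_real (of_int (pos x j) - e)) = edge_point (nb x (j + 1)) x (1 - e)"
    unfolding half_plane_point_of_real
    using assms by (subst trail_eq[of "pos x j - 1"]) (auto simp: c_pos c_pos_pred)
  then show "half_plane_point (even j) (of_int (pos x j) - of_real e) = edge_point x (nb x (j + 1)) e"
    using edge_point_swap[of x "nb x (j + 1)" e] by simp
qed

text \<open>The radius is chosen such that closed half discs of radius \<open>3/4\<close> about the corners of the
  half planes contain a neighbourhood of every edge, but no second corner.\<close>

definition star_radius :: real where
  "star_radius = root m (3 / 4)"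

lemma star_radius: "star_radius ^ m = 3 / 4" "0 < star_radius"
  using m_pos by (simp_all add: star_radius_def)

lemma power_star_radius:
  assumes "0 \<le> \<rho>"
  shows "\<rho> ^ m \<le> 3 / 4 \<longleftrightarrow> \<rho> \<le> star_radius" "\<rho> ^ m < 3 / 4 \<longleftrightarrow> \<rho> < star_radius"
proof -
  have "\<rho> ^ m \<le> star_radius ^ m \<longleftrightarrow> \<rho> \<le> star_radius" "star_radius ^ m \<le> \<rho> ^ m \<longleftrightarrow> star_radius \<le> \<rho>"
    using assms star_radius(2) m_pos by (intro power_mono_iff; simp)+
  then show "\<rho> ^ m \<le> 3 / 4 \<longleftrightarrow> \<rho> \<le> star_radius" "\<rho> ^ m < 3 / 4 \<longleftrightarrow> \<rho> < star_radius"
    unfolding star_radius(1) by linarith+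
qed

section \<open>Stars of the vertices\<close>

text \<open>Parametrization of the sector between the rays \<open>j\<close> and \<open>j + 1\<close> of the star of a vertex. The cone angle
  \<open>2 * pi * m\<close> is reduced to \<open>2 * pi\<close>.\<close>

definition star_point :: "int \<Rightarrow> real \<Rightarrow> real \<Rightarrow> complex" where
  "star_point j \<rho> \<alpha> = of_real \<rho> * cis ((\<alpha> + pi * of_int j) / real m)"

definition corner_value :: "nat \<Rightarrow> int \<Rightarrow> complex \<Rightarrow> nat \<Rightarrow> real" where
  "corner_value x j e = half_plane_point (even j) (of_int (pos x j) + e)"

lemma norm_star_point: "0 \<le> \<rho> \<Longrightarrow> norm (star_point j \<rho> \<alpha>) = \<rho>"
  by (simp add: star_point_def norm_mult)

lemma cis_pi_int: "cis (pi * of_int j) = parity_sign (even j)"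
proof (cases "even j")
  case True
  then obtain k where "j = 2 * k" by blast
  then have "cis (pi * of_int j) = cis (2 * pi * of_int k)" by (simp add: mult_ac)
  then show ?thesis using True cis_multiple_2pi[of "of_int k"] by (simp only: parity_sign_def) simp
next
  case False
  then obtain k where "j = 2 * k + 1" by (auto elim: oddE)
  then have "pi * of_int j = 2 * pi * of_int k + pi" by (simp add: algebra_simps)
  then have "cis (pi * of_int j) = cis (2 * pi * of_int k) * cis pi" by (simp only: cis_mult)
  then show ?thesis using False cis_multiple_2pi[of "of_int k"] by (simp only: parity_sign_def) simp
qed

text \<open>The \<open>m\<close>-th power opens a sector of width \<open>pi / m\<close> to a half
  plane: the upper one for even \<open>j\<close>, the lower one for odd \<open>j\<close>. The sign
  turns the latter back.\<close>

lemma star_point_power: "star_point j \<rho> \<alpha> ^ m = parity_sign (even j) * (of_real (\<rho> ^ m) * cis \<alpha>)"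
proof -
  have "star_point j \<rho> \<alpha> ^ m = of_real (\<rho> ^ m) * cis (real m * ((\<alpha> + pi * of_int j) / real m))"
    by (simp only: star_point_def power_mult_distrib of_real_power Complex.DeMoivre)
  also have "real m * ((\<alpha> + pi * of_int j) / real m) = \<alpha> + pi * of_int j"
    using m_pos by simp
  finally show ?thesis by (simp add: cis_mult[symmetric] cis_pi_int mult_ac)
qed

lemma star_point_period: "star_point (j + 2 * int m * n) \<rho> \<alpha> = star_point j \<rho> \<alpha>"
proof -
  have "(\<alpha> + pi * of_int (j + 2 * int m * n)) / real m = (\<alpha> + pi * of_int j) / real m + 2 * pi * of_int n"
    using m_pos by (simp add: field_simps)
  then show ?thesis
    by (simp only: star_point_def cis_mult[symmetric] cis_multiple_2pi Ints_of_int) simp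
qed

lemma star_point_pi: "star_point j \<rho> pi = star_point (j + 1) \<rho> 0"
  by (simp add: star_point_def algebra_simps)

text \<open>Up to full turns of the star, the angles \<open>\<alpha>\<close> and
  \<open>\<alpha>'\<close> differ by a multiple of \<open>pi\<close> of size at most
  \<open>pi\<close>; so the points share a sector or lie on a common ray of two neighbouring
  ones.\<close>

lemma star_point_eqD:
  assumes "star_point j \<rho> \<alpha> = star_point j' \<rho> \<alpha>'" "0 < \<rho>" "0 \<le> \<alpha>" "\<alpha> \<le> pi" "0 \<le> \<alpha>'" "\<alpha>' \<le> pi"
  obtains n \<delta> where "\<delta> \<in> {-1, 0, 1}" "j' = j + \<delta> + 2 * int m * n" "\<alpha> = \<alpha>' + pi * of_int \<delta>"
proof -
  have "cis ((\<alpha> + pi * of_int j) / real m) = cis ((\<alpha>' + pi * of_int j') / real m)"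
    using assms(1,2) by (simp add: star_point_def)
  then obtain n :: int where "(\<alpha> + pi * of_int j) / real m = (\<alpha>' + pi * of_int j') / real m + 2 * pi * of_int n"
    using sin_cos_eq_iff[of "(\<alpha> + pi * of_int j) / real m"] by (auto simp: complex_eq_iff)
  then have "\<alpha> + pi * of_int j = \<alpha>' + pi * of_int j' + 2 * pi * of_int n * real m"
    using m_pos by (simp add: field_simps)
  then have eq: "\<alpha> - \<alpha>' = pi * of_int (j' + 2 * int m * n - j)" by (simp add: algebra_simps)
  define \<delta> where "\<delta> = j' + 2 * int m * n - j"
  have "\<bar>pi * of_int \<delta>\<bar> \<le> pi * 1" using eq assms unfolding \<delta>_def by linarith
  then have "\<bar>of_int \<delta>\<bar> \<le> (1::real)" using pi_gt_zero by (simp add: abs_mult)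
  then have "\<delta> \<in> {-1, 0, 1}" by auto
  moreover have "j' = j + \<delta> + 2 * int m * (- n)" by (simp add: \<delta>_def)
  moreover have "\<alpha> = \<alpha>' + pi * of_int \<delta>" using eq \<delta>_def by simp
  ultimately show thesis using that by blast
qed

lemma star_point_surj:
  assumes "norm u \<le> star_radius"
  obtains j \<alpha> where "0 \<le> j" "j < 2 * int m" "0 \<le> \<alpha>" "\<alpha> \<le> pi" "u = star_point j (norm u) \<alpha>"
proof -
  define \<phi> where "\<phi> = real m * Arg2pi u / pi"
  have \<phi>: "0 \<le> \<phi>" using Arg2pi_ge_0[of u] by (simp add: \<phi>_def)
  have "real m * Arg2pi u < real m * (2 * pi)" using Arg2pi_lt_2pi[of u] m_pos by simp
  then have "\<phi> < 2 * real m" by (simp add: \<phi>_def field_simps)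
  then have "\<lfloor>\<phi>\<rfloor> < 2 * int m" by (simp add: floor_less_iff)
  moreover have "u = star_point \<lfloor>\<phi>\<rfloor> (norm u) (pi * frac \<phi>)"
  proof -
    have "(pi * frac \<phi> + pi * of_int \<lfloor>\<phi>\<rfloor>) / real m = Arg2pi u"
      using m_pos by (simp add: frac_def \<phi>_def right_diff_distrib)
    then show ?thesis using Arg2pi_eq[of u] by (simp only: star_point_def cis_conv_exp)
  qed
  ultimately show thesis
    using that[of "\<lfloor>\<phi>\<rfloor>" "pi * frac \<phi>"] \<phi> frac_lt_1[of \<phi>] by (simp add: mult_left_le)
qed

lemma corner_value_period: "corner_value x (j + 2 * int m * n) e = corner_value x j e"
  by (simp add: corner_value_def pos_period)

lemma corner_value_ray:
  assumes "x < v" "0 \<le> \<rho>" "\<rho> \<le> star_radius"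
  shows "corner_value x j (of_real (\<rho> ^ m)) = edge_point x (nb x j) (\<rho> ^ m)"
    and "corner_value x j (- of_real (\<rho> ^ m)) = edge_point x (nb x (j + 1)) (\<rho> ^ m)"
  using half_plane_point_ray[OF assms(1), of "\<rho> ^ m" j] assms power_star_radius(1)[of \<rho>]
  by (simp_all add: corner_value_def)

text \<open>Two different sectors meet only at the centre, which both send to the vertex, or along a
  common ray. There one sector has the angle \<open>pi\<close>, the other 0, and both run along the
  same edge.\<close>

lemma corner_value_consistent:
  assumes "x < v" "0 \<le> \<rho>" "\<rho> \<le> star_radius" "0 \<le> \<alpha>" "\<alpha> \<le> pi" "0 \<le> \<alpha>'" "\<alpha>' \<le> pi"
    and eq: "star_point j \<rho> \<alpha> = star_point j' \<rho> \<alpha>'"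
  shows "corner_value x j (of_real (\<rho> ^ m) * cis \<alpha>) = corner_value x j' (of_real (\<rho> ^ m) * cis \<alpha>')"
proof (cases "\<rho> = 0")
  case True
  then have 0: "\<rho> ^ m = 0" using m_pos by simp
  show ?thesis
    using corner_value_ray(1)[OF assms(1-3), of j] corner_value_ray(1)[OF assms(1-3), of j']
      edge_point_0[of x "nb x j" "nb x j'"] by (simp add: 0)
next
  case False
  then obtain n \<delta> where \<delta>: "\<delta> \<in> {-1, 0, 1}" "j' = j + \<delta> + 2 * int m * n" "\<alpha> = \<alpha>' + pi * of_int \<delta>"
    using star_point_eqD[OF eq] assms by (metis less_eq_real_def)
  note ray = corner_value_ray[OF assms(1-3)]
  have j': "corner_value x j' e = corner_value x (j + \<delta>) e" for e
    by (simp only: \<delta>(2) corner_value_period)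
  consider "\<delta> = 0" | "\<delta> = 1" "\<alpha> = pi" "\<alpha>' = 0" | "\<delta> = -1" "\<alpha> = 0" "\<alpha>' = pi"
    using \<delta>(1,3) assms by auto
  then show ?thesis
  proof cases
    case 1
    then show ?thesis using \<delta> j' by simp
  next
    case 2
    then show ?thesis using ray(1)[of "j + 1"] ray(2)[of j] j' by simp
  next
    case 3
    then show ?thesis using ray(1)[of j] ray(2)[of "j - 1"] j' by simp
  qed
qed

definition sector :: "int \<Rightarrow> complex set" where
  "sector j = (\<lambda>(\<rho>, \<alpha>). star_point j \<rho> \<alpha>) ` ({0..star_radius} \<times> {0..pi})"

lemma star_exists:
  assumes "x < v"
  obtains p where "continuous_on (cball 0 star_radius) p"
    "\<And>j \<rho> \<alpha>. \<lbrakk>0 \<le> \<rho>; \<rho> \<le> star_radius; 0 \<le> \<alpha>; \<alpha> \<le> pi\<rbrakk> \<Longrightarrow>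
       p (star_point j \<rho> \<alpha>) = corner_value x j (of_real (\<rho> ^ m) * cis \<alpha>)"
proof -
  \<comment> \<open>Writing the value through \<open>u ^ m\<close> gives on each sector a function
    of \<open>u\<close> itself, without choosing an argument.\<close>
  let ?f = "\<lambda>j u. corner_value x j (parity_sign (even j) * u ^ m)"
  let ?B = "cball 0 star_radius :: complex set"
  have f: "?f j (star_point j \<rho> \<alpha>) = corner_value x j (of_real (\<rho> ^ m) * cis \<alpha>)" for j \<rho> \<alpha>
    by (simp add: star_point_power)
  have sector: "closed (sector j)" "sector j \<subseteq> ?B" for j
  proof -
    have "continuous_on ({0..star_radius} \<times> {0..pi}) (\<lambda>(\<rho>, \<alpha>). star_point j \<rho> \<alpha>)"
      unfolding star_point_def cis_conv_exp case_prod_unfold using m_pos by (intro continuous_intros) simp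
    then have "compact (sector j)"
      unfolding sector_def by (intro compact_continuous_image compact_Times) auto
    then show "closed (sector j)" by (rule compact_imp_closed)
    show "sector j \<subseteq> ?B" by (auto simp: sector_def norm_star_point)
  qed
  have cont: "continuous_on (sector j) (?f j)" for j
    unfolding corner_value_def
  proof (rule continuous_on_compose2[OF continuous_on_half_plane_point])
    show "continuous_on (sector j) (\<lambda>u. of_int (pos x j) + parity_sign (even j) * u ^ m)"
      by (intro continuous_intros)
    show "(\<lambda>u. of_int (pos x j) + parity_sign (even j) * u ^ m) ` sector j \<subseteq> {t. 0 \<le> Im t}"
      by (auto simp: sector_def star_point_power sin_ge_zero)
  qed
  have agree: "?f i u = ?f j u" if ui: "u \<in> sector i" and uj: "u \<in> sector j" for i j u
  proof -
    obtain \<rho> \<alpha> where u: "u = star_point i \<rho> \<alpha>" "0 \<le> \<rho>" "\<rho> \<le> star_radius" "0 \<le> \<alpha>" "\<alpha> \<le> pi"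
      using ui by (auto simp: sector_def)
    obtain \<rho>' \<alpha>' where u': "u = star_point j \<rho>' \<alpha>'" "0 \<le> \<rho>'" "\<rho>' \<le> star_radius" "0 \<le> \<alpha>'" "\<alpha>' \<le> pi"
      using uj by (auto simp: sector_def)
    have "\<rho>' = \<rho>" using norm_star_point u u' by metis
    then show ?thesis
      using corner_value_consistent[OF assms u(2-5) u'(4,5), of i j] u(1) u'(1) f[of i \<rho> \<alpha>] f[of j \<rho> \<alpha>'] by simp
  qed
  obtain p where p: "continuous_map (top_of_set ?B) euclidean p"
    "\<And>u i. \<lbrakk>i \<in> {0..<2 * int m}; u \<in> topspace (top_of_set ?B) \<inter> sector i\<rbrakk> \<Longrightarrow> p u = ?f i u"
  proof (rule pasting_lemma_exists_closed[of "{0..<2 * int m}" "top_of_set ?B" sector euclidean ?f])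
    show "topspace (top_of_set ?B) \<subseteq> \<Union> (sector ` {0..<2 * int m})"
    proof
      fix u assume "u \<in> topspace (top_of_set ?B)"
      then have u: "norm u \<le> star_radius" by simp
      then obtain j \<alpha> where "0 \<le> j" "j < 2 * int m" "0 \<le> \<alpha>" "\<alpha> \<le> pi" "u = star_point j (norm u) \<alpha>"
        by (rule star_point_surj)
      with u have "u \<in> sector j" unfolding sector_def by (intro image_eqI[of _ _ "(norm u, \<alpha>)"]) auto
      with \<open>0 \<le> j\<close> \<open>j < 2 * int m\<close> show "u \<in> \<Union> (sector ` {0..<2 * int m})" by auto
    qed
    show "closedin (top_of_set ?B) (sector i)" for i
      using sector by (simp add: closed_subset)
    show "continuous_map (subtopology (top_of_set ?B) (sector i)) euclidean (?f i)" for i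
      using cont[of i] sector(2)[of i] by (simp add: subtopology_subtopology inf.absorb2)
  qed (use agree in auto)
  show thesis
  proof
    show "continuous_on ?B p" using p(1) by simp
    fix j \<rho> \<alpha> assume *: "0 \<le> \<rho>" "\<rho> \<le> star_radius" "0 \<le> \<alpha>" "\<alpha> \<le> pi"
    \<comment> \<open>Only one turn of sectors has been pasted; the other indices follow by
      periodicity.\<close>
    define i where "i = j mod (2 * int m)"
    have j: "j = i + 2 * int m * (j div (2 * int m))" by (simp add: i_def)
    have i: "i \<in> {0..<2 * int m}" using m_pos by (simp add: i_def)
    have "star_point j \<rho> \<alpha> = star_point i \<rho> \<alpha>" by (subst j) (rule star_point_period)
    moreover have "star_point i \<rho> \<alpha> \<in> sector i"
      unfolding sector_def using * by (intro image_eqI[of _ _ "(\<rho>, \<alpha>)"]) auto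
    moreover have "corner_value x j e = corner_value x i e" for e by (subst j) (rule corner_value_period)
    ultimately show "p (star_point j \<rho> \<alpha>) = corner_value x j (of_real (\<rho> ^ m) * cis \<alpha>)"
      using p(2)[OF i, of "star_point i \<rho> \<alpha>"] sector(2)[of i] f[of i \<rho> \<alpha>] by auto
  qed
qed

definition is_star :: "nat \<Rightarrow> (complex \<Rightarrow> nat \<Rightarrow> real) \<Rightarrow> bool" where
  "is_star x p \<longleftrightarrow> continuous_on (cball 0 star_radius) p \<and>
     (\<forall>j \<rho> \<alpha>. 0 \<le> \<rho> \<longrightarrow> \<rho> \<le> star_radius \<longrightarrow> 0 \<le> \<alpha> \<longrightarrow> \<alpha> \<le> pi \<longrightarrow>
       p (star_point j \<rho> \<alpha>) = corner_value x j (of_real (\<rho> ^ m) * cis \<alpha>))"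

definition star :: "nat \<Rightarrow> complex \<Rightarrow> nat \<Rightarrow> real" where
  "star x = (SOME p. is_star x p)"

lemma
  assumes "x < v"
  shows continuous_on_star: "continuous_on (cball 0 star_radius) (star x)"
    and star_star_point: "\<lbrakk>0 \<le> \<rho>; \<rho> \<le> star_radius; 0 \<le> \<alpha>; \<alpha> \<le> pi\<rbrakk> \<Longrightarrow>
      star x (star_point j \<rho> \<alpha>) = corner_value x j (of_real (\<rho> ^ m) * cis \<alpha>)"
proof -
  obtain p where "is_star x p" using star_exists[OF assms] unfolding is_star_def by metis
  then have "is_star x (star x)" unfolding star_def by (rule someI[where P = "is_star x"])
  then show "continuous_on (cball 0 star_radius) (star x)"
    and "\<lbrakk>0 \<le> \<rho>; \<rho> \<le> star_radius; 0 \<le> \<alpha>; \<alpha> \<le> pi\<rbrakk> \<Longrightarrow>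
      star x (star_point j \<rho> \<alpha>) = corner_value x j (of_real (\<rho> ^ m) * cis \<alpha>)"
    unfolding is_star_def by blast+
qed

lemma nb_less: "x < v \<Longrightarrow> nb x j < v"
  using c_pos_Suc[of x j] c_less[of "even j" "pos x j + 1"] by simp

lemma star_ray:
  assumes "x < v" "0 \<le> \<rho>" "\<rho> \<le> star_radius"
  shows "star x (star_point j \<rho> 0) = edge_point x (nb x j) (\<rho> ^ m)"
  using star_star_point[OF assms, of 0 j] corner_value_ray(1)[OF assms, of j] by simp

definition corner_point :: "nat \<Rightarrow> int \<Rightarrow> real \<Rightarrow> real \<Rightarrow> complex" where
  "corner_point x j \<rho> \<alpha> = of_int (pos x j) + of_real (\<rho> ^ m) * cis \<alpha>"

lemma Im_corner_point: "Im (corner_point x j \<rho> \<alpha>) = \<rho> ^ m * sin \<alpha>"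
  by (simp add: corner_point_def)

lemma star_half_plane_point:
  assumes "x < v" "0 \<le> \<rho>" "\<rho> \<le> star_radius" "0 \<le> \<alpha>" "\<alpha> \<le> pi"
  shows "star x (star_point j \<rho> \<alpha>) = half_plane_point (even j) (corner_point x j \<rho> \<alpha>)"
  by (simp only: star_star_point[OF assms] corner_value_def corner_point_def)

text \<open>Rays, the centre included, are sent to the graph, where barycentric coordinates decide
  equality; open sectors are sent into the discs, where the half plane does.\<close>

lemma star_point_cases:
  assumes "norm u \<le> star_radius"
  obtains (ray) j where "u = star_point j (norm u) 0"
  | (inner) j \<alpha> where "u = star_point j (norm u) \<alpha>" "0 < norm u" "0 < \<alpha>" "\<alpha> < pi"
proof -
  obtain j \<alpha> where j: "0 \<le> \<alpha>" "\<alpha> \<le> pi" "u = star_point j (norm u) \<alpha>"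
    using star_point_surj[OF assms] by metis
  consider "u = 0" | "\<alpha> = 0" | "\<alpha> = pi" | "0 < norm u" "0 < \<alpha>" "\<alpha> < pi"
    using j by fastforce
  then show thesis
  proof cases
    case 1
    then show thesis using ray[of 0] by (simp add: star_point_def)
  next
    case 2
    then show thesis using ray[of j] j by simp
  next
    case 3
    then show thesis using ray[of "j + 1"] j by (metis star_point_pi)
  next
    case 4
    then show thesis using inner[of j \<alpha>] j by blast
  qed
qed

lemma inner_Im_pos: "\<lbrakk>0 < \<rho>; 0 < \<alpha>; \<alpha> < pi\<rbrakk> \<Longrightarrow> 0 < Im (corner_point x j \<rho> \<alpha>)"
  by (simp add: Im_corner_point sin_gt_zero)

lemma norm_corner_point: "0 \<le> \<rho> \<Longrightarrow> norm (corner_point x j \<rho> \<alpha> - of_int (pos x j)) = \<rho> ^ m"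
  by (simp add: corner_point_def norm_mult norm_power)

text \<open>After a shift by whole periods the two corner times differ by at most
  \<open>3 / 4 + 3 / 4\<close>, thus by at most 1. Both are visits of \<open>x\<close>, and
  consecutive vertices are distinct, so the times agree and \<open>pos_inj\<close> identifies the
  sectors.\<close>

lemma corner_point_eqD:
  assumes x: "x < v" and "0 < \<rho>" "\<rho> \<le> star_radius" "0 \<le> \<alpha>" "\<alpha> \<le> pi"
    and "0 \<le> \<rho>'" "\<rho>' \<le> star_radius" "0 \<le> \<alpha>'" "\<alpha>' \<le> pi"
    and par: "even j = even j'" and eq: "corner_point x j \<rho> \<alpha> = corner_point x j' \<rho>' \<alpha>' + of_int (int N * n)"
  shows "star_point j \<rho> \<alpha> = star_point j' \<rho>' \<alpha>'"
proof -
  define \<delta> where "\<delta> = pos x j' + int N * n - pos x j"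
  have \<delta>: "of_real (\<rho> ^ m) * cis \<alpha> - of_real (\<rho>' ^ m) * cis \<alpha>' = of_int \<delta>"
    using eq by (simp add: corner_point_def \<delta>_def algebra_simps)
  have "norm (of_real (\<rho> ^ m) * cis \<alpha> - of_real (\<rho>' ^ m) * cis \<alpha>') \<le> \<rho> ^ m + \<rho>' ^ m"
    using norm_triangle_ineq4[of "of_real (\<rho> ^ m) * cis \<alpha>" "of_real (\<rho>' ^ m) * cis \<alpha>'"] assms
    by (simp add: norm_mult norm_power)
  also have "\<dots> \<le> 3 / 2"
    using power_star_radius(1)[of \<rho>] power_star_radius(1)[of \<rho>'] assms by simp
  finally have "\<bar>real_of_int \<delta>\<bar> \<le> 3 / 2" unfolding \<delta> by simp
  then have "\<delta> \<in> {-1, 0, 1}" by auto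
  moreover have c: "c (even j) (pos x j' + int N * n + i) = c (even j) (pos x j' + i)" for i
    using c_period[of "even j" "pos x j' + i" n] by (simp add: algebra_simps)
  have "c (even j) (pos x j) = x" "c (even j) (pos x j') = x"
    using c_pos[OF x, of j] c_pos[OF x, of j'] par by simp_all
  moreover have "c (even j) (pos x j' + 1) \<noteq> x" "c (even j) (pos x j' - 1) \<noteq> x"
    using c_pos_Suc[OF x, of j'] c_pos_pred[OF x, of j'] nb_neq[OF x] par by simp_all
  moreover have "pos x j = pos x j' + int N * n - \<delta>" by (simp add: \<delta>_def)
  ultimately have "\<delta> = 0" using c[of 1] c[of "-1"] by auto
  then have "pos x j = pos x j' + int N * n" by (simp add: \<delta>_def)
  then have "[j = j'] (mod (2 * int m))" using pos_inj[OF x par] by blast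
  then obtain k where k: "j = j' + 2 * int m * k"
    by (metis cong_iff_lin cong_sym)
  have e: "of_real (\<rho> ^ m) * cis \<alpha> = of_real (\<rho>' ^ m) * cis \<alpha>'" using \<delta> \<open>\<delta> = 0\<close> by simp
  then have "norm (of_real (\<rho> ^ m) * cis \<alpha>) = norm (of_real (\<rho>' ^ m) * cis \<alpha>')" by simp
  then have "\<rho> ^ m = \<rho>' ^ m" using assms by (simp add: norm_mult norm_power)
  then have \<rho>: "\<rho> = \<rho>'" using assms m_pos by (simp add: power_eq_iff_eq_base)
  with e assms(2) have "cis \<alpha> = cis \<alpha>'" by simp
  then have "cos \<alpha> = cos \<alpha>'" by (simp add: complex_eq_iff)
  then have "\<alpha> = \<alpha>'" using assms cos_inj_pi by metis
  with \<rho> k show ?thesis by (simp add: star_point_period)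
qed

lemma edge_point_nb_eqD:
  assumes x: "x < v" and "0 \<le> \<rho>" "0 \<le> \<rho>'" and eq: "edge_point x (nb x j) (\<rho> ^ m) = edge_point x (nb x j') (\<rho>' ^ m)"
  shows "star_point j \<rho> 0 = star_point j' \<rho>' 0"
proof -
  have "\<rho> ^ m = \<rho>' ^ m" and nb: "\<rho> ^ m = 0 \<or> nb x j = nb x j'"
    using edge_point_eqD_same[OF eq] nb_neq[OF x] by auto
  then have \<rho>: "\<rho> = \<rho>'" using assms m_pos by (simp add: power_eq_iff_eq_base)
  from nb show ?thesis
  proof
    assume "\<rho> ^ m = 0"
    then show ?thesis using \<rho> m_pos by (simp add: star_point_def)
  next
    assume "nb x j = nb x j'"
    then have "[j = j'] (mod (2 * int m))" using nb_inj[OF x] by blast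
    then obtain k where "j = j' + 2 * int m * k" by (metis cong_iff_lin cong_sym)
    with \<rho> show ?thesis by (simp add: star_point_period)
  qed
qed

text \<open>A point inside a disc has positive height in the half plane, which forces the other
  preimage into an open sector too. Two vertices are allowed because the overlaps of stars need this
  as well.\<close>

lemma star_inner_eqD:
  assumes x: "x < v" and y: "y < v" and u: "norm u \<le> star_radius" and w: "norm w \<le> star_radius"
    and eq: "star x u = star y w"
    and j: "u = star_point j (norm u) \<alpha>" "0 < norm u" "0 < \<alpha>" "\<alpha> < pi"
  obtains j' \<beta> n where "w = star_point j' (norm w) \<beta>" "0 < norm w" "0 < \<beta>" "\<beta> < pi" "even j = even j'"
    "corner_point x j (norm u) \<alpha> = corner_point y j' (norm w) \<beta> + of_int (int N * n)"
proof -
  obtain j' \<beta> where j': "0 \<le> \<beta>" "\<beta> \<le> pi" "w = star_point j' (norm w) \<beta>"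
    using star_point_surj[OF w] by metis
  have "half_plane_point (even j) (corner_point x j (norm u) \<alpha>) = half_plane_point (even j') (corner_point y j' (norm w) \<beta>)"
    using star_half_plane_point[OF x, of "norm u" \<alpha> j] star_half_plane_point[OF y, of "norm w" \<beta> j'] eq u w j j' by simp
  moreover have pos: "0 < Im (corner_point x j (norm u) \<alpha>)" using inner_Im_pos j by blast
  moreover have "0 \<le> Im (corner_point y j' (norm w) \<beta>)"
    using j' by (simp add: Im_corner_point sin_ge_zero)
  ultimately obtain n where n: "even j = even j'"
      "corner_point x j (norm u) \<alpha> = corner_point y j' (norm w) \<beta> + of_int (int N * n)"
    using half_plane_point_eqD by metis
  then have "Im (corner_point x j (norm u) \<alpha>) = Im (corner_point y j' (norm w) \<beta>)" by simp
  with pos have p: "0 < norm w ^ m * sin \<beta>" by (simp add: Im_corner_point)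
  then have "norm w \<noteq> 0" "sin \<beta> \<noteq> 0" using m_pos by (auto simp: zero_power)
  then have "0 < norm w" "\<beta> \<noteq> 0" "\<beta> \<noteq> pi" by auto
  then show thesis using that[of j' \<beta> n] j' n by simp
qed

lemma star_inj_inner:
  assumes x: "x < v" and u: "norm u \<le> star_radius" and w: "norm w \<le> star_radius" and eq: "star x u = star x w"
    and j: "u = star_point j (norm u) \<alpha>" "0 < norm u" "0 < \<alpha>" "\<alpha> < pi"
  shows "u = w"
proof -
  obtain j' \<beta> n where j': "w = star_point j' (norm w) \<beta>" "0 < norm w" "0 < \<beta>" "\<beta> < pi" "even j = even j'"
    "corner_point x j (norm u) \<alpha> = corner_point x j' (norm w) \<beta> + of_int (int N * n)"
    using star_inner_eqD[OF x x u w eq j] by blast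
  have "star_point j (norm u) \<alpha> = star_point j' (norm w) \<beta>"
    using u w j j' by (intro corner_point_eqD[OF x _ _ _ _ _ _ _ _ j'(5,6)]) simp_all
  then show "u = w" using j(1) j'(1) by simp
qed

lemma inj_on_star:
  assumes x: "x < v"
  shows "inj_on (star x) (cball 0 star_radius)"
proof (rule inj_onI)
  fix u w assume "u \<in> cball 0 star_radius" "w \<in> cball 0 star_radius" and eq: "star x u = star x w"
  then have u: "norm u \<le> star_radius" and w: "norm w \<le> star_radius" by simp_all
  show "u = w"
    using u
  proof (cases u rule: star_point_cases)
    case (inner j \<alpha>)
    then show ?thesis by (rule star_inj_inner[OF x u w eq])
  next
    case j: (ray j)
    show ?thesis
      using w
    proof (cases w rule: star_point_cases)
      case (inner j' \<beta>)
      then show ?thesis by (rule star_inj_inner[OF x w u eq[symmetric], symmetric])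
    next
      case j': (ray j')
      have "star x u = edge_point x (nb x j) (norm u ^ m)" "star x w = edge_point x (nb x j') (norm w ^ m)"
        using star_ray[OF x, of "norm u" j] star_ray[OF x, of "norm w" j'] u w j j' by simp_all
      then have "star_point j (norm u) 0 = star_point j' (norm w) 0"
        using edge_point_nb_eqD[OF x, of "norm u" "norm w" j j'] eq by simp
      then show ?thesis using j j' by simp
    qed
  qed
qed

lemma disc_point_in_surf: "norm z \<le> 1 \<Longrightarrow> disc_point s z \<in> surf"
  unfolding surf_def by (intro UN_I[of s] imageI) auto

text \<open>Full discs are taken, although only their upper halves lead into the closed unit disc:
  the region is then open in the plane, and removing it from the closed disc leaves a compact
  set.\<close>

definition corner_region :: "bool \<Rightarrow> nat \<Rightarrow> complex set" where
  "corner_region s x = expN ` (\<Union>j\<in>{j. even j = s}. ball (of_int (pos x j)) (3 / 4))"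

lemma open_corner_region: "open (corner_region s x)"
  unfolding corner_region_def
proof (rule open_mapping_thm[of expN UNIV])
  show "expN holomorphic_on UNIV" unfolding expN_def using N_pos by (intro holomorphic_intros) simp
  show "\<not> expN constant_on UNIV"
  proof
    assume "expN constant_on UNIV"
    then obtain y where "\<And>t. expN t = y" by (auto simp: constant_on_def)
    then have "expN 0 = expN \<i>" by metis
    then have "norm (expN 0) = norm (expN \<i>)" by simp
    then show False using N_pos by (simp add: norm_expN)
  qed
qed auto

lemma in_star_if_corner_region:
  assumes x: "x < v" and z: "norm z \<le> 1" "z \<in> corner_region s x"
  shows "disc_point s z \<in> star x ` ball 0 star_radius"
proof -
  obtain j t where j: "even j = s" "norm (t - of_int (pos x j)) < 3 / 4" "z = expN t"
    using z(2) by (auto simp: corner_region_def dist_norm norm_minus_commute)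
  define e where "e = t - of_int (pos x j)"
  have t: "0 \<le> Im t" using z(1) j(3) norm_expN_le by simp
  define \<rho> where "\<rho> = root m (norm e)"
  have \<rho>: "0 \<le> \<rho>" "\<rho> ^ m = norm e" using m_pos by (simp_all add: \<rho>_def)
  then have \<rho>r: "\<rho> < star_radius" using power_star_radius(2)[of \<rho>] j(2) by (simp add: e_def)
  have Arg: "0 \<le> Arg e" "Arg e \<le> pi" using t Arg_le_pi[of e] by (auto simp: e_def Arg_less_0)
  have "e = of_real (norm e) * cis (Arg e)" using rcis_cmod_Arg[of e] by (simp add: rcis_def)
  then have "corner_point x j \<rho> (Arg e) = t" by (simp add: corner_point_def \<rho>(2) e_def)
  then have "star x (star_point j \<rho> (Arg e)) = disc_point s z"
    using star_half_plane_point[OF x \<rho>(1) _ Arg, of j] \<rho>r j by (simp add: half_plane_point_def)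
  moreover have "star_point j \<rho> (Arg e) \<in> ball 0 star_radius" using \<rho>(1) \<rho>r by (simp add: norm_star_point)
  ultimately show ?thesis by (metis image_eqI)
qed

lemma corner_region_if_in_star:
  assumes x: "x < v" and z: "norm z \<le> 1" and zx: "disc_point s z \<in> star x ` ball 0 star_radius"
  shows "z \<in> corner_region s x"
proof -
  obtain u where u: "norm u < star_radius" "disc_point s z = star x u" using zx by auto
  then have u': "norm u \<le> star_radius" by simp
  have um: "norm u ^ m < 3 / 4" using power_star_radius(2)[of "norm u"] u by simp
  from u' show ?thesis
  proof (cases u rule: star_point_cases)
    case (inner j \<alpha>)
    let ?t = "corner_point x j (norm u) \<alpha>"
    have "disc_point s z = disc_point (even j) (expN ?t)"
      using u star_half_plane_point[OF x _ u', of \<alpha> j] inner by (simp add: half_plane_point_def)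
    moreover have "norm (expN ?t) < 1" using inner inner_Im_pos norm_expN_less by simp
    ultimately have "s = even j" "z = expN ?t" using disc_point_inj[of "even j" "expN ?t" s z] z by auto
    moreover have "?t \<in> ball (of_int (pos x j)) (3 / 4)"
      using norm_corner_point[of "norm u" x j \<alpha>] um by (simp add: dist_norm norm_minus_commute)
    ultimately show ?thesis unfolding corner_region_def by blast
  next
    case (ray j)
    have eq: "disc_point s z = edge_point x (nb x j) (norm u ^ m)"
      using u star_ray[OF x _ u', of j] ray by simp
    have "norm z = 1"
    proof (rule ccontr)
      assume "norm z \<noteq> 1"
      moreover have "disc_point s z v = 0"
        unfolding eq using x nb_less[OF x, of j] by (simp add: edge_point_def)
      ultimately show False by (auto simp: disc_point_v parity_sign_def split: if_splits)
    qed
    then obtain \<tau> where \<tau>: "z = angle \<tau>" using sphere_angle by blast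
    have "trail (c s) \<tau> = edge_point x (nb x j) (norm u ^ m)" using eq \<tau> disc_point_angle by simp
    then have tx: "trail (c s) \<tau> x = 1 - norm u ^ m" using nb_neq[OF x] by (simp add: edge_point_fst)
    then obtain i where i: "c s i = x" "\<bar>\<tau> - of_int i\<bar> = norm u ^ m"
      using trail_pos_imp_near[of "c s" \<tau> x] um c_Suc_neq by auto
    \<comment> \<open>The corner \<open>k\<close> belongs to the circuit \<open>s\<close>; it need
      not be \<open>j\<close>, whose parity is unrelated to \<open>s\<close> on a ray.\<close>
    from pos_surj[OF i(1)] obtain k n where k: "even k = s" "i = pos x k + int N * n" by blast
    define t where "t = complex_of_real (\<tau> - real N * of_int n)"
    have "t - of_int (pos x k) = of_real (\<tau> - of_int i)" by (simp add: t_def k(2))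
    then have "norm (t - of_int (pos x k)) < 3 / 4" using i(2) um by (simp del: of_real_diff)
    then have "t \<in> ball (of_int (pos x k)) (3 / 4)" by (simp add: dist_norm norm_minus_commute)
    moreover have "z = expN t"
    proof -
      have "expN (t + of_int (int N * n)) = expN t" by (rule expN_period)
      moreover have "t + of_int (int N * n) = of_real \<tau>" by (simp add: t_def)
      ultimately show ?thesis using \<tau> expN_of_real by metis
    qed
    ultimately show ?thesis unfolding corner_region_def using k(1) by blast
  qed
qed

lemma star_subset_surf:
  assumes x: "x < v"
  shows "star x ` cball 0 star_radius \<subseteq> surf"
proof (rule image_subsetI)
  fix u :: complex assume "u \<in> cball 0 star_radius"
  then have u: "norm u \<le> star_radius" by simp
  then obtain j \<alpha> where j: "0 \<le> \<alpha>" "\<alpha> \<le> pi" "u = star_point j (norm u) \<alpha>"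
    using star_point_surj by metis
  then have "star x u = disc_point (even j) (expN (corner_point x j (norm u) \<alpha>))"
    using star_half_plane_point[OF x _ u, of \<alpha> j] by (simp add: half_plane_point_def)
  moreover have "norm (expN (corner_point x j (norm u) \<alpha>)) \<le> 1"
    using j by (simp add: norm_expN_le Im_corner_point sin_ge_zero)
  ultimately show "star x u \<in> surf" by (simp add: disc_point_in_surf)
qed

text \<open>The complement of the star is the image of what remains of the two closed discs outside
  the corner regions, hence compact.\<close>

lemma openin_star:
  assumes x: "x < v"
  shows "openin (top_of_set surf) (star x ` ball 0 star_radius)"
proof -
  let ?C = "\<Union>s. disc_point s ` (cball 0 1 - corner_region s x)"
  have "compact ?C"
    using open_corner_region continuous_on_disc_point
    by (intro compact_UN compact_continuous_image compact_diff)
       (auto intro: continuous_on_subset)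
  then have "openin (top_of_set surf) (surf \<inter> - ?C)"
    by (intro openin_open_Int open_Compl compact_imp_closed)
  moreover have "surf \<inter> - ?C = star x ` ball 0 star_radius"
  proof (intro equalityI subsetI)
    fix y assume y: "y \<in> surf \<inter> - ?C"
    then obtain s z where "norm z \<le> 1" "y = disc_point s z" by (auto simp: surf_def)
    moreover have "y \<notin> disc_point s ` (cball 0 1 - corner_region s x)" using y by blast
    ultimately have "norm z \<le> 1" "y = disc_point s z" "z \<in> corner_region s x" by auto
    then show "y \<in> star x ` ball 0 star_radius" using in_star_if_corner_region[OF x] by simp
  next
    fix y assume y: "y \<in> star x ` ball 0 star_radius"
    then have "y \<in> surf" using star_subset_surf[OF x] ball_subset_cball by blast
    moreover have "y \<notin> ?C"
    proof
      assume "y \<in> ?C"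
      then obtain s z where z: "norm z \<le> 1" "z \<notin> corner_region s x" "y = disc_point s z" by auto
      then show False using corner_region_if_in_star[OF x z(1)] y by blast
    qed
    ultimately show "y \<in> surf \<inter> - ?C" by blast
  qed
  ultimately show ?thesis by simp
qed

lemma surf_cover: "surf \<subseteq> (\<Union>s. face s) \<union> (\<Union>x<v. star x ` ball 0 star_radius)"
proof
  fix y assume "y \<in> surf"
  then obtain s z where z: "norm z \<le> 1" "y = disc_point s z" by (auto simp: surf_def)
  show "y \<in> (\<Union>s. face s) \<union> (\<Union>x<v. star x ` ball 0 star_radius)"
  proof (cases "norm z < 1")
    case True
    then have "y \<in> face s" using z by (simp add: face_def)
    then show ?thesis by blast
  next
    case False
    then obtain \<tau> where \<tau>: "z = angle \<tau>" using sphere_angle z(1) by force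
    \<comment> \<open>The nearest visit is at most \<open>1 / 2\<close> away in time, which is less
      than the radius \<open>3 / 4\<close>; so the stars cover the whole graph.\<close>
    define i where "i = round \<tau>"
    have i: "\<bar>\<tau> - of_int i\<bar> \<le> 1 / 2" using of_int_round_abs_le[of \<tau>] by (simp add: i_def abs_minus_commute)
    obtain k n where k: "even k = s" "i = pos (c s i) k + int N * n" using pos_surj by blast
    define t where "t = complex_of_real (\<tau> - real N * of_int n)"
    have "t - of_int (pos (c s i) k) = of_real (\<tau> - of_int i)" by (subst (2) k(2)) (simp add: t_def)
    then have "norm (t - of_int (pos (c s i) k)) < 3 / 4" using i by (simp del: of_real_diff)
    then have "t \<in> ball (of_int (pos (c s i) k)) (3 / 4)" by (simp add: dist_norm norm_minus_commute)
    moreover have "z = expN t"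
    proof -
      have "expN (t + of_int (int N * n)) = expN t" by (rule expN_period)
      moreover have "t + of_int (int N * n) = of_real \<tau>" by (simp add: t_def)
      ultimately show ?thesis using \<tau> expN_of_real by metis
    qed
    ultimately have "z \<in> corner_region s (c s i)" unfolding corner_region_def using k(1) by blast
    then have "y \<in> star (c s i) ` ball 0 star_radius" using in_star_if_corner_region c_less z by blast
    then show ?thesis using c_less by blast
  qed
qed

end

lemma simplex_points_edge:
  assumes "a \<noteq> b"
  shows "simplex_points {a, b} = edge_point a b ` {0..1}"
proof (intro equalityI subsetI)
  fix x assume "x \<in> simplex_points {a, b}"
  then have x: "\<And>w. 0 \<le> x w" "\<And>w. w \<notin> {a, b} \<Longrightarrow> x w = 0" "x a + x b = 1"
    using assms by (auto simp: simplex_points_def)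
  have "x = edge_point a b (x b)"
    using x(2,3) assms by (force simp: edge_point_def)
  moreover have "x b \<in> {0..1}" using x(1)[of a] x(1)[of b] x(3) by simp
  ultimately show "x \<in> edge_point a b ` {0..1}" by blast
next
  fix x assume "x \<in> edge_point a b ` {0..1}"
  then show "x \<in> simplex_points {a, b}"
    using assms by (auto simp: simplex_points_def edge_point_def)
qed

lemma exp_2pi_add_int: "exp (2 * of_real pi * \<i> * (t + of_int k)) = exp (2 * of_real pi * \<i> * t)"
proof -
  have "exp (2 * of_real pi * \<i> * of_int k) = 1"
    using exp_integer_2pi[of "of_int k"] by (simp add: mult_ac)
  then show ?thesis by (simp add: distrib_left exp_add)
qed

section \<open>The branched covering and the atlas\<close>

context circuit_pair
begin

text \<open>In the half plane this is \<open>exp (2 * pi * \<i> * t)\<close> or its inverse. At the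
  centre of the disc \<open>False\<close> the value should be infinity and is 0 by convention; that
  point lies in no other chart.\<close>

definition face_cover :: "bool \<Rightarrow> complex \<Rightarrow> complex" where
  "face_cover s z = (if s then z ^ N else inverse (z ^ N))"

text \<open>Up to sign \<open>u ^ m\<close> is the displacement from a corner time. Corner times are
  integers and drop out of the exponential, so one formula serves all vertices.\<close>

definition star_cover :: "complex \<Rightarrow> complex" where
  "star_cover u = exp (2 * of_real pi * \<i> * u ^ m)"

lemma face_cover_deriv:
  assumes "z \<noteq> 0"
  shows "\<exists>D. D \<noteq> 0 \<and> (face_cover s has_field_derivative D) (at z)"
proof (cases s)
  case True
  then have "face_cover s = (\<lambda>z. z ^ N)" by (simp add: face_cover_def fun_eq_iff)
  moreover have "((\<lambda>z. z ^ N) has_field_derivative of_nat N * z ^ (N - 1)) (at z)"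
    by (auto intro!: derivative_eq_intros)
  moreover have "of_nat N * z ^ (N - 1) \<noteq> 0" using assms N_pos by simp
  ultimately show ?thesis by metis
next
  case False
  let ?D = "- (inverse (z ^ N) * (of_nat N * z ^ (N - 1)) * inverse (z ^ N))"
  have "face_cover s = (\<lambda>z. inverse (z ^ N))" using False by (simp add: face_cover_def fun_eq_iff)
  moreover have "((\<lambda>z. z ^ N) has_field_derivative of_nat N * z ^ (N - 1)) (at z)"
    by (auto intro!: derivative_eq_intros)
  then have "((\<lambda>z. inverse (z ^ N)) has_field_derivative ?D) (at z)"
    using assms by (intro DERIV_inverse') simp_all
  moreover have "?D \<noteq> 0" using assms N_pos by simp
  ultimately show ?thesis by metis
qed

lemma star_cover_deriv:
  assumes "u \<noteq> 0"
  shows "\<exists>D. D \<noteq> 0 \<and> (star_cover has_field_derivative D) (at u)"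
proof -
  have "((\<lambda>u. 2 * of_real pi * \<i> * u ^ m) has_field_derivative 2 * of_real pi * \<i> * (of_nat m * u ^ (m - 1))) (at u)"
    by (auto intro!: derivative_eq_intros)
  then have "(star_cover has_field_derivative exp (2 * of_real pi * \<i> * u ^ m) * (2 * of_real pi * \<i> * (of_nat m * u ^ (m - 1)))) (at u)"
    unfolding star_cover_def[abs_def] by (rule DERIV_fun_exp)
  moreover have "exp (2 * of_real pi * \<i> * u ^ m) * (2 * of_real pi * \<i> * (of_nat m * u ^ (m - 1))) \<noteq> 0"
    using assms m_pos by simp
  ultimately show ?thesis by metis
qed

lemma edge_point_v: "\<lbrakk>x < v; y < v\<rbrakk> \<Longrightarrow> edge_point x y t v = 0"
  by (simp add: edge_point_def)

text \<open>Overlaps avoid the rays, where coordinate \<open>v\<close> vanishes. The sign of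
  \<open>u ^ m\<close> in odd sectors matches the inverse in
  \<open>face_cover False\<close>.\<close>

lemma face_star_cover:
  assumes x: "x < v" and z: "norm z < 1" and u: "norm u < star_radius" and eq: "disc_point s z = star x u"
  shows "z \<noteq> 0 \<and> u \<noteq> 0 \<and> face_cover s z = star_cover u"
proof -
  have u': "norm u \<le> star_radius" using u by simp
  then show ?thesis
  proof (cases u rule: star_point_cases)
    case (ray j)
    then have "disc_point s z v = 0"
      using star_ray[OF x _ u', of j] eq edge_point_v[OF x nb_less[OF x]] by simp
    then show ?thesis using z by (auto simp: disc_point_v parity_sign_def split: if_splits)
  next
    case (inner j \<alpha>)
    let ?t = "corner_point x j (norm u) \<alpha>" and ?e = "of_real (norm u ^ m) * cis \<alpha>"
    have "disc_point s z = disc_point (even j) (expN ?t)"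
      using eq star_half_plane_point[OF x _ u', of \<alpha> j] inner by (simp add: half_plane_point_def)
    moreover have "norm (expN ?t) < 1" using inner inner_Im_pos norm_expN_less by simp
    ultimately have s: "s = even j" "z = expN ?t" using disc_point_inj[OF _ z] by auto
    have "z ^ N = exp (2 * of_real pi * \<i> * (?e + of_int (pos x j)))"
      by (simp only: s(2) expN_power corner_point_def add.commute)
    then have zN: "z ^ N = exp (2 * of_real pi * \<i> * ?e)" by (simp only: exp_2pi_add_int)
    have um: "u ^ m = parity_sign (even j) * ?e"
      by (subst inner(1)) (rule star_point_power)
    have "face_cover s z = star_cover u"
      unfolding face_cover_def star_cover_def zN um s(1)
      by (simp add: parity_sign_def exp_minus)
    moreover have "z \<noteq> 0" by (simp add: s(2) expN_def)
    ultimately show ?thesis using inner(2) by auto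
  qed
qed

lemma star_star_cover_inner:
  assumes x: "x < v" and y: "y < v" and u: "norm u \<le> star_radius" and w: "norm w \<le> star_radius"
    and eq: "star x u = star y w"
    and j: "u = star_point j (norm u) \<alpha>" "0 < norm u" "0 < \<alpha>" "\<alpha> < pi"
  shows "u \<noteq> 0 \<and> w \<noteq> 0 \<and> star_cover u = star_cover w"
proof -
  obtain j' \<beta> n where j': "w = star_point j' (norm w) \<beta>" "0 < norm w" "even j = even j'"
    "corner_point x j (norm u) \<alpha> = corner_point y j' (norm w) \<beta> + of_int (int N * n)"
    using star_inner_eqD[OF x y u w eq j] by metis
  let ?e = "of_real (norm u ^ m) * cis \<alpha>" and ?e' = "of_real (norm w ^ m) * cis \<beta>"
  define k where "k = pos y j' + int N * n - pos x j"
  have e: "?e = ?e' + of_int k"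
    using j'(4) by (simp add: corner_point_def k_def algebra_simps)
  have um: "u ^ m = parity_sign (even j) * ?e" by (subst j(1)) (rule star_point_power)
  have wm: "w ^ m = parity_sign (even j) * ?e'" by (subst j'(1), subst j'(3)) (rule star_point_power)
  have "u ^ m = w ^ m + of_int (parity_sign (even j) * k)"
    unfolding um wm e by (simp add: parity_sign_def)
  then have "star_cover u = star_cover w"
    unfolding star_cover_def by (simp only: exp_2pi_add_int)
  then show ?thesis using j(2) j'(2) by auto
qed

lemma star_star_cover:
  assumes x: "x < v" and y: "y < v" and "x \<noteq> y" and u: "norm u < star_radius" and w: "norm w < star_radius"
    and eq: "star x u = star y w"
  shows "u \<noteq> 0 \<and> w \<noteq> 0 \<and> star_cover u = star_cover w"
proof -
  have u': "norm u \<le> star_radius" and w': "norm w \<le> star_radius" using u w by simp_all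
  from u' show ?thesis
  proof (cases u rule: star_point_cases)
    case (inner j \<alpha>)
    then show ?thesis by (rule star_star_cover_inner[OF x y u' w' eq])
  next
    case j: (ray j)
    from w' show ?thesis
    proof (cases w rule: star_point_cases)
      case (inner j' \<beta>)
      then have "w \<noteq> 0 \<and> u \<noteq> 0 \<and> star_cover w = star_cover u"
        by (rule star_star_cover_inner[OF y x w' u' eq[symmetric]])
      then show ?thesis by auto
    next
      case j': (ray j')
      have "edge_point x (nb x j) (norm u ^ m) = edge_point y (nb y j') (norm w ^ m)"
        using star_ray[OF x _ u', of j] star_ray[OF y _ w', of j'] j j' eq by simp
      moreover have lt: "norm u ^ m < 1" "norm w ^ m < 1"
        using power_star_radius(2)[of "norm u"] power_star_radius(2)[of "norm w"] u w by simp_all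
      ultimately have nb: "nb x j = y" "nb y j' = x" and uw: "norm u ^ m = 1 - norm w ^ m"
        using edge_point_eqD_distinct[OF _ nb_neq[OF x] nb_neq[OF y] \<open>x \<noteq> y\<close>] by metis+
      have "nb (nb x j) j' = x" using nb by simp
      \<comment> \<open>The edge is the ray \<open>j\<close> of \<open>x\<close> and the ray
        \<open>j'\<close> of \<open>y\<close>. Opposite parities give \<open>u ^ m\<close> and
        \<open>w ^ m\<close> opposite signs, and their moduli add up to 1, so they differ by an
        integer. With equal parities the coverings would not match.\<close>
      then have par: "even j \<noteq> even j'" by (rule nb_parity[OF x])
      have um: "u ^ m = parity_sign (even j) * of_real (norm u ^ m)"
        using star_point_power[of j "norm u" 0] j by simp
      have wm: "w ^ m = parity_sign (even j') * of_real (norm w ^ m)"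
        using star_point_power[of j' "norm w" 0] j' by simp
      have "u ^ m = w ^ m + of_int (parity_sign (even j))"
        using par unfolding um wm uw by (auto simp: parity_sign_def)
      then have "star_cover u = star_cover w" unfolding star_cover_def by (simp only: exp_2pi_add_int)
      moreover have "u \<noteq> 0" "w \<noteq> 0" using uw lt m_pos by (auto simp: zero_power)
      ultimately show ?thesis by blast
    qed
  qed
qed

text \<open>Stars are defined on closed discs so that compactness makes the inverse
  continuous.\<close>

lemma homeomorphism_star:
  assumes "x < v"
  shows "\<exists>g. homeomorphism (ball 0 star_radius) (star x ` ball 0 star_radius) (star x) g"
proof -
  obtain g where "homeomorphism (cball 0 star_radius) (star x ` cball 0 star_radius) (star x) g"
    using homeomorphism_compact[OF compact_cball continuous_on_star[OF assms] refl inj_on_star[OF assms]] by blast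
  then have "homeomorphism (ball 0 star_radius) (star x ` ball 0 star_radius) (star x) g"
    by (rule homeomorphism_of_subsets) auto
  then show ?thesis by blast
qed

lemma orientable_surf: "orientable (top_of_set surf)"
  and surf_charts: "\<forall>x\<in>surf. \<exists>U \<phi>. x \<in> U \<and> plane_chart (top_of_set surf) U \<phi>"
proof -
  let ?I = "range Inl \<union> Inr ` {..<v} :: (bool + nat) set"
  let ?p = "case_sum disc_point star"
  let ?W = "case_sum (\<lambda>s::bool. ball 0 1) (\<lambda>x::nat. ball (0 :: complex) star_radius)"
  let ?b = "case_sum face_cover (\<lambda>x. star_cover)"
  have op: "openin (top_of_set surf) (?p i ` ?W i)" if "i \<in> ?I" for i
    using that openin_face openin_star by (auto simp: face_def)
  have hom: "\<exists>g. homeomorphism (?W i) (?p i ` ?W i) (?p i) g" if "i \<in> ?I" for i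
  proof (cases i)
    case (Inl s)
    then show ?thesis using homeomorphism_face[of s] unfolding face_def by (intro exI[of _ face_coordinate]) simp
  next
    case (Inr x)
    then show ?thesis using that homeomorphism_star[of x] by auto
  qed
  have cov: "surf \<subseteq> (\<Union>i\<in>?I. ?p i ` ?W i)"
    using surf_cover by (auto simp: face_def)
  have b: "?b i u = ?b j w \<and> (\<exists>D. D \<noteq> 0 \<and> (?b i has_field_derivative D) (at u))"
    if ij: "i \<in> ?I" "j \<in> ?I" "i \<noteq> j" and uw: "u \<in> ?W i" "w \<in> ?W j" and eq: "?p i u = ?p j w" for i j u w
  proof (cases i; cases j)
    fix s s' assume "i = Inl s" "j = Inl s'"
    then show ?thesis using ij uw eq disc_point_inj(1)[of s u s' w] by auto
  next
    fix s x assume "i = Inl s" "j = Inr x"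
    then show ?thesis using ij uw eq face_star_cover[of x u w s] face_cover_deriv[of u s] by auto
  next
    fix s x assume "i = Inr x" "j = Inl s"
    then show ?thesis using ij uw eq face_star_cover[of x w u s] star_cover_deriv[of u] by auto
  next
    fix x y assume "i = Inr x" "j = Inr y"
    then show ?thesis using ij uw eq star_star_cover[of x y u w] star_cover_deriv[of u] by auto
  qed
  have W: "open (?W i)" if "i \<in> ?I" for i by (cases i) auto
  note atlas = orientable_of_parametrizations[where I = ?I and W = ?W and X = surf and p = ?p and \<beta> = ?b, OF W op hom cov b]
  show "orientable (top_of_set surf)" by (rule atlas(1))
  show "\<forall>x\<in>surf. \<exists>U \<phi>. x \<in> U \<and> plane_chart (top_of_set surf) U \<phi>" by (rule atlas(2))
qed

section \<open>The circuits are Eulerian\<close>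

abbreviation edges :: "nat set set" where
  "edges \<equiv> complete_edges {..<v}"

text \<open>By counting: the \<open>2 * m\<close> rays at \<open>x\<close> lead to distinct vertices
  among the \<open>2 * m\<close> others.\<close>

lemma nb_surj:
  assumes x: "x < v" and y: "y < v" "y \<noteq> x"
  obtains j where "nb x j = y"
proof -
  have "inj_on (nb x) {0..<2 * int m}"
    by (auto intro!: inj_onI dest!: nb_inj[OF x] simp: cong_less_imp_eq_int)
  then have "card (nb x ` {0..<2 * int m}) = 2 * m" by (simp add: card_image)
  moreover have "nb x ` {0..<2 * int m} \<subseteq> {..<v} - {x}"
    using nb_less[OF x] nb_neq[OF x] by auto
  moreover have "card ({..<v} - {x}) = 2 * m" using x by (simp add: v_eq)
  ultimately have "nb x ` {0..<2 * int m} = {..<v} - {x}"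
    by (intro card_subset_eq) auto
  then have "y \<in> nb x ` {0..<2 * int m}" using y by simp
  then show thesis using that by blast
qed

text \<open>The ray \<open>j\<close> at \<open>a\<close> bounds the corners \<open>j\<close> and
  \<open>j - 1\<close>, which belong to different circuits: one circuit leaves \<open>a\<close>
  along it, the other enters.\<close>

lemma edge_on_circuit:
  assumes "e \<in> edges"
  obtains i where "e = {c s i, c s (i + 1)}"
proof -
  obtain a b where ab: "e = {a, b}" "a \<noteq> b" "a < v" "b < v"
    using assms by (auto simp: complete_edges_def card_2_iff)
  then obtain j where j: "nb a j = b" using nb_surj by metis
  show thesis
  proof (cases "even j = s")
    case True
    then show thesis using that[of "pos a j"] c_pos[OF ab(3), of j] c_pos_Suc[OF ab(3), of j] ab j by simp
  next
    case False
    then have "even (j - 1) = s" by auto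
    then show thesis
      using that[of "pos a (j - 1) - 1"] c_pos[OF ab(3), of "j - 1"] c_pos_pred[OF ab(3), of "j - 1"] ab j
      by (simp add: insert_commute)
  qed
qed

lemma circuit_step_edge: "{c s i, c s (i + 1)} \<in> edges"
  using c_less[of s i] c_less[of s "i + 1"] c_Suc_neq[of s i] by (simp add: complete_edges_def)

text \<open>Two passes in the same direction share their corner by \<open>nb_inj\<close>. Opposite
  directions would need corners of different parity by \<open>nb_parity\<close>, yet both belong to
  the circuit \<open>s\<close>.\<close>

lemma circuit_step_inj:
  assumes "{c s i, c s (i + 1)} = {c s k, c s (k + 1)}"
  shows "\<exists>n. i = k + int N * n"
proof -
  obtain j n where j: "even j = s" "i = pos (c s i) j + int N * n" using pos_surj[OF refl, of s i] by metis
  obtain l n' where l: "even l = s" "k = pos (c s k) l + int N * n'" using pos_surj[OF refl, of s k] by metis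
  have nxt: "c s (pos x j + int N * n + 1) = nb x j" if "even j = s" "x < v" for x j n
    using c_period[of s "pos x j + 1" n] c_pos_Suc[OF that(2), of j] that(1) by (simp add: algebra_simps)
  have i1: "c s (i + 1) = nb (c s i) j"
    using nxt[OF j(1) c_less[of s i], of n] j(2) by simp
  have k1: "c s (k + 1) = nb (c s k) l"
    using nxt[OF l(1) c_less[of s k], of n'] l(2) by simp
  show ?thesis
  proof (cases "c s i = c s k")
    case True
    then have "nb (c s i) j = nb (c s i) l"
      using assms i1 k1 nb_neq[OF c_less] by (auto simp: doubleton_eq_iff)
    then have "[j = l] (mod (2 * int m))" by (rule nb_inj[OF c_less])
    then obtain q where "j = l + 2 * int m * q" by (metis cong_iff_lin cong_sym)
    then have "pos (c s i) j = pos (c s k) l" using True pos_period by simp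
    then have "i = k + int N * (n - n')" using j(2) l(2) by (simp add: algebra_simps)
    then show ?thesis by blast
  next
    case False
    then have "c s i = c s (k + 1)" "c s (i + 1) = c s k"
      using assms by (auto simp: doubleton_eq_iff)
    then have "c s k = nb (c s i) j" "c s i = nb (c s k) l"
      using i1 k1 by simp_all
    then have "nb (nb (c s i) j) l = c s i" by simp
    then have "even j \<noteq> even l" by (rule nb_parity[OF c_less])
    then show ?thesis using j l by simp
  qed
qed

definition circuit_list :: "bool \<Rightarrow> nat list" where
  "circuit_list s = map (\<lambda>i. c s (int i)) [0..<N]"

lemma length_circuit_list [simp]: "length (circuit_list s) = N"
  by (simp add: circuit_list_def)

lemma circuit_list_nth: "i < N \<Longrightarrow> circuit_list s ! i = c s (int i)"
  by (simp add: circuit_list_def)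

lemma circuit_list_nth_Suc:
  assumes "i < N"
  shows "circuit_list s ! (Suc i mod N) = c s (int i + 1)"
proof -
  have "circuit_list s ! (Suc i mod N) = c s (int (Suc i mod N))"
    using N_pos by (intro circuit_list_nth) simp
  also have "\<dots> = c s (int (Suc i mod N) + int N * int (Suc i div N))" by (rule c_period[symmetric])
  also have "int (Suc i mod N) + int N * int (Suc i div N) = int (Suc i)"
    by (metis mod_mult_div_eq of_nat_add of_nat_mult)
  finally show ?thesis by (simp add: add.commute)
qed

lemma circuit_edge_list: "i < N \<Longrightarrow> circuit_edge (circuit_list s) i = {c s (int i), c s (int i + 1)}"
  by (simp only: circuit_edge_def circuit_list_nth circuit_list_nth_Suc length_circuit_list)

lemma circuit_edges_list: "circuit_edges (circuit_list s) = edges"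
proof
  show "circuit_edges (circuit_list s) \<subseteq> edges"
    using circuit_step_edge by (auto simp: circuit_edges_def circuit_edge_list)
  show "edges \<subseteq> circuit_edges (circuit_list s)"
  proof
    fix e assume "e \<in> edges"
    then obtain i where i: "e = {c s i, c s (i + 1)}" by (rule edge_on_circuit)
    define k where "k = nat (i mod int N)"
    have k: "k < N" "int k = i mod int N" using N_pos by (simp_all add: k_def nat_less_iff)
    have "c s (int k + a) = c s (i + a)" for a
      using c_period[of s "int k + a" "i div int N"] k(2) by (simp add: algebra_simps)
    from this[of 0] this[of 1] have "e = circuit_edge (circuit_list s) k"
      using k(1) i by (simp add: circuit_edge_list)
    then show "e \<in> circuit_edges (circuit_list s)" using k(1) by (simp add: circuit_edges_def)
  qed
qed

lemma circuit_circuit_list: "circuit edges (circuit_list s)"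
proof -
  have "inj_on (circuit_edge (circuit_list s)) {..<N}"
  proof (rule inj_onI)
    fix i k assume ik: "i \<in> {..<N}" "k \<in> {..<N}" "circuit_edge (circuit_list s) i = circuit_edge (circuit_list s) k"
    then have "\<exists>n. int i = int k + int N * n"
      by (intro circuit_step_inj[of s]) (simp add: circuit_edge_list)
    then have "int i mod int N = int k mod int N" by auto
    then show "i = k" using ik by simp
  qed
  moreover have "circuit_list s \<noteq> []" using N_pos by (metis length_circuit_list length_0_conv less_numeral_extra(3))
  ultimately show ?thesis by (simp add: circuit_def circuit_edges_list)
qed

lemma circuit_decomposition_list: "circuit_decomposition edges {circuit_list s}"
  by (simp add: circuit_decomposition_def circuit_circuit_list disjoint_family_on_def circuit_edges_list)

end

section \<open>The embedded graph\<close>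

lemma connected_components_of_two_open:
  assumes "openin X A" "openin X B" "connectedin X A" "connectedin X B"
    and "A \<noteq> {}" "B \<noteq> {}" "A \<inter> B = {}" "topspace X = A \<union> B"
  shows "connected_components_of X = {A, B}"
proof -
  have comp: "connected_component_of_set X x = A"
    if "openin X A" "openin X B" "connectedin X A" "A \<inter> B = {}" "topspace X = A \<union> B" "x \<in> A" for A B x
  proof
    have "A = topspace X - B" using that(4,5) by blast
    then have "closedin X A" using that(2) by auto
    then show "connected_component_of_set X x \<subseteq> A"
      using connectedin_clopen_cases[OF connectedin_connected_component_of _ that(1), of x] that(5,6)
        connected_component_of_refl[of X x] by (auto simp: disjnt_iff)
    show "A \<subseteq> connected_component_of_set X x"
      using that by (intro connected_component_of_maximal)
  qed
  have "connected_component_of_set X x = A" if "x \<in> A" for x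
    using comp[of A B x] assms that by simp
  moreover have "connected_component_of_set X x = B" if "x \<in> B" for x
    using comp[of B A x] assms that by (simp add: Int_commute Un_commute)
  ultimately show ?thesis
    using assms(5,6) unfolding connected_components_of_def assms(8) image_Un by auto
qed

context circuit_pair
begin

abbreviation graph :: "(nat \<Rightarrow> real) set" where
  "graph \<equiv> topspace (graph_space {..<v} edges)"

lemma graph_eq_edges: "graph = (\<Union>e\<in>edges. simplex_points e)"
proof -
  have "\<exists>e\<in>edges. simplex_points {x} \<subseteq> simplex_points e" if x: "x < v" for x
  proof
    have "nb x 0 < v" "nb x 0 \<noteq> x" using nb_less[OF x] nb_neq[OF x] by auto
    then show "{x, nb x 0} \<in> edges" using x by (simp add: complete_edges_def)
    show "simplex_points {x} \<subseteq> simplex_points {x, nb x 0}"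
      using \<open>nb x 0 \<noteq> x\<close> by (auto simp: simplex_points_def)
  qed
  then show ?thesis unfolding graph_space_def by fastforce
qed

text \<open>Either disc will do, since each circuit is Eulerian. Thus the graph, in its own
  barycentric coordinates, is a subset of the surface, and the identity can serve as the
  embedding.\<close>

lemma graph_eq_sphere: "graph = disc_point s ` sphere 0 1"
proof (intro equalityI subsetI)
  fix y assume "y \<in> graph"
  then obtain e where e: "e \<in> edges" "y \<in> simplex_points e" unfolding graph_eq_edges by blast
  obtain i where i: "e = {c s i, c s (i + 1)}" using edge_on_circuit[OF e(1)] by blast
  then obtain t where t: "0 \<le> t" "t \<le> 1" "y = edge_point (c s i) (c s (i + 1)) t"
    using e(2) simplex_points_edge[of "c s i" "c s (i + 1)"] c_Suc_neq[of s i] by auto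
  then have "y = trail (c s) (of_int i + t)" by (subst trail_eq[of i]) simp_all
  then have "y = disc_point s (angle (of_int i + t))" by (simp add: disc_point_angle)
  then show "y \<in> disc_point s ` sphere 0 1" by simp
next
  fix y assume "y \<in> disc_point s ` sphere 0 1"
  then obtain z where z: "norm z = 1" "y = disc_point s z" by auto
  then obtain \<tau> where \<tau>: "z = angle \<tau>" using sphere_angle by blast
  let ?i = "\<lfloor>\<tau>\<rfloor>"
  have "y = edge_point (c s ?i) (c s (?i + 1)) (frac \<tau>)"
    using z(2) \<tau> by (simp add: disc_point_angle trail_def)
  moreover have "frac \<tau> \<in> {0..1}" using frac_lt_1[of \<tau>] by simp
  ultimately have "y \<in> simplex_points {c s ?i, c s (?i + 1)}"
    using simplex_points_edge[of "c s ?i" "c s (?i + 1)"] c_Suc_neq[of s ?i] by auto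
  then show "y \<in> graph" unfolding graph_eq_edges using circuit_step_edge by blast
qed

lemma disc_eq: "disc_point s ` cball 0 1 = face s \<union> graph"
proof -
  have "cball (0::complex) 1 = ball 0 1 \<union> sphere 0 1" by auto
  then show ?thesis by (simp add: face_def graph_eq_sphere[of s] image_Un)
qed

lemma surf_eq: "surf = face True \<union> face False \<union> graph"
  using disc_eq by (auto simp: surf_def) (metis (full_types) UN_I UNIV_I UnE)+

lemma graph_v: "y \<in> graph \<Longrightarrow> y v = 0"
  by (auto simp: graph_eq_sphere[of True] disc_point_v)

lemma face_v: "y \<in> face s \<Longrightarrow> 0 < parity_sign s * y v"
  by (simp add: face_eq)

lemma face_disjoint: "face s \<inter> graph = {}" "s \<noteq> s' \<Longrightarrow> face s \<inter> face s' = {}"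
proof -
  show "face s \<inter> graph = {}" using graph_v face_v by fastforce
  show "face s \<inter> face s' = {}" if "s \<noteq> s'"
    using that face_v[of _ s] face_v[of _ s'] by (cases s; cases s') (fastforce simp: parity_sign_def)+
qed

lemma face_nonempty: "face s \<noteq> {}"
  by (simp add: face_def)

lemma connected_face: "connected (face s)"
  unfolding face_def
  by (intro connected_continuous_image continuous_on_subset[OF continuous_on_disc_point]) auto

lemma faces_surf: "faces {..<v} edges (top_of_set surf) (\<lambda>y. y) = {face True, face False}"
proof -
  have X: "subtopology (top_of_set surf) (topspace (top_of_set surf) - (\<lambda>y. y) ` graph)
      = top_of_set (face True \<union> face False)"
  proof -
    have "surf \<inter> (surf - graph) = face True \<union> face False"
      using surf_eq face_disjoint(1)[of True] face_disjoint(1)[of False] by blast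
    then show ?thesis by (simp add: subtopology_subtopology)
  qed
  have op: "openin (top_of_set (face True \<union> face False)) (face s)" for s
  proof (rule openin_subset_trans[OF openin_face])
    show "face s \<subseteq> face True \<union> face False" by (cases s) auto
    show "face True \<union> face False \<subseteq> surf" using surf_eq by blast
  qed
  have "connected_components_of (top_of_set (face True \<union> face False)) = {face True, face False}"
    using face_disjoint(2)[of True False]
    by (intro connected_components_of_two_open op face_nonempty) (simp_all add: connectedin_subtopology connected_face)
  then show ?thesis unfolding faces_def X .
qed

text \<open>The disc itself, restricted to the annulus, is the collar; what it leaves uncovered is
  the image of the closed disc of radius \<open>1 / 2\<close>.\<close>

lemma face_boundary_surf: "face_boundary edges (top_of_set surf) (\<lambda>y. y) (face s) (circuit_list s)"
  unfolding face_boundary_def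
proof (intro conjI exI[of _ "disc_point s"] ballI allI impI)
  show "circuit edges (circuit_list s)" by (rule circuit_circuit_list)
  have "{z :: complex. 1 / 2 \<le> norm z \<and> norm z \<le> 1} \<subseteq> cball 0 1" by auto
  then show "continuous_map (top_of_set {z. 1 / 2 \<le> norm z \<and> norm z \<le> 1}) (top_of_set surf) (disc_point s)"
    using continuous_on_subset[OF continuous_on_disc_point] by (auto simp: continuous_map_in_subtopology disc_point_in_surf)
  show "inj_on (disc_point s) {z. 1 / 2 \<le> norm z \<and> norm z < 1}"
    using disc_point_inj(2)[of s _ s] by (auto intro!: inj_onI)
  show "disc_point s ` {z. 1 / 2 \<le> norm z \<and> norm z < 1} \<subseteq> face s"
    by (auto simp: face_def)
  have "face s - disc_point s ` {z. 1 / 2 < norm z \<and> norm z < 1} = disc_point s ` cball 0 (1 / 2)"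
  proof -
    have "inj_on (disc_point s) (ball 0 1)"
      using disc_point_inj(2)[of s _ s] by (auto intro!: inj_onI)
    then have "disc_point s ` ball 0 1 - disc_point s ` {z. 1 / 2 < norm z \<and> norm z < 1}
        = disc_point s ` (ball 0 1 - {z. 1 / 2 < norm z \<and> norm z < 1})"
      by (intro inj_on_image_set_diff[symmetric]) auto
    moreover have "ball 0 1 - {z. 1 / 2 < norm z \<and> norm z < 1} = cball (0::complex) (1 / 2)" by auto
    ultimately show ?thesis by (simp add: face_def)
  qed
  moreover have "compact (disc_point s ` cball 0 (1 / 2))"
    by (intro compact_continuous_image continuous_on_subset[OF continuous_on_disc_point]) auto
  moreover have "disc_point s ` cball 0 (1 / 2) \<subseteq> surf" by (auto simp: disc_point_in_surf)
  ultimately show "compactin (top_of_set surf) (face s - disc_point s ` {z. 1 / 2 < norm z \<and> norm z < 1})"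
    by (simp add: compactin_subtopology)
next
  fix i and t :: real assume i: "i < length (circuit_list s)" and t: "t \<in> {0..1}"
  have "disc_point s (cis (2 * pi * (real i + t) / real N)) = trail (c s) (of_int (int i) + t)"
    using disc_point_angle[of s "real i + t"] by simp
  also have "\<dots> = edge_point (c s (int i)) (c s (int i + 1)) t"
    using t by (subst trail_eq[of "int i"]) auto
  finally show "disc_point s (cis (2 * pi * (real i + t) / real (length (circuit_list s)))) =
      edge_point (circuit_list s ! i) (circuit_list s ! (Suc i mod length (circuit_list s))) t"
    using i by (simp only: length_circuit_list circuit_list_nth circuit_list_nth_Suc)
qed

text \<open>The closure of each face contains the image of the closed disc, and with it the whole
  graph; so every edge borders both faces.\<close>

lemma edge_on_face_surf:
  assumes "e \<in> edges"
  shows "edge_on_face (top_of_set surf) (\<lambda>y. y) e (face s)"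
proof -
  have sub: "face s \<subseteq> surf" using openin_face openin_imp_subset by blast
  have "closure (ball (0::complex) 1) = cball 0 1" by (rule closure_ball) simp
  then have "disc_point s ` cball 0 1 \<subseteq> closure (face s)"
    using image_closure_subset[of "ball 0 1" "disc_point s" "closure (face s)"] continuous_on_disc_point[of s]
      closure_subset[of "face s"] by (simp add: face_def)
  then have "graph \<subseteq> closure (face s)" using disc_eq by blast
  moreover have "graph \<subseteq> surf" using surf_eq by blast
  ultimately have "graph \<subseteq> top_of_set surf closure_of face s"
    using sub by (simp add: closure_of_subtopology inf.absorb2)
  moreover have "top_of_set surf interior_of face s = face s"
    using openin_face by (simp add: interior_of_openin)
  ultimately have "graph \<subseteq> top_of_set surf frontier_of face s"
    using face_disjoint(1)[of s] by (auto simp: frontier_of_def)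
  then show ?thesis unfolding edge_on_face_def graph_eq_edges using assms by auto
qed

lemma surface_surf: "surface (top_of_set surf)"
proof -
  have "connected surf"
  proof -
    have "connected (disc_point s ` cball 0 1)" for s
      using continuous_on_disc_point by (intro connected_continuous_image) auto
    moreover have "disc_point True ` cball 0 1 \<inter> disc_point False ` cball 0 1 \<noteq> {}"
    proof -
      have "disc_point True 1 \<in> graph" unfolding graph_eq_sphere[of True] by (rule imageI) simp
      then show ?thesis unfolding disc_eq by blast
    qed
    ultimately have "connected (disc_point True ` cball 0 1 \<union> disc_point False ` cball 0 1)"
      by (intro connected_Un)
    moreover have "disc_point True ` cball 0 1 \<union> disc_point False ` cball 0 1 = surf"
      unfolding disc_eq surf_eq by blast
    ultimately show ?thesis by simp
  qed
  then show ?thesis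
    using surf_charts compact_surf
    by (auto simp: surface_def Hausdorff_space_subtopology compact_space_subtopology connected_space_subtopology)
qed

lemma biembedding_surf: "biembedding {..<v} edges (top_of_set surf) (\<lambda>y. y)"
  unfolding biembedding_def
proof (rule conjI, goal_cases embedding colouring)
  case embedding
  have "graph \<subseteq> surf" using surf_eq by blast
  then show ?case
    unfolding graph_embedding_def graph_space_def by (auto simp: continuous_map_in_subtopology)
next
  case colouring
  have "{face True} \<inter> {face False} = {}"
    using face_disjoint(2)[of True False] face_nonempty by auto
  moreover have "{face True} \<union> {face False} = faces {..<v} edges (top_of_set surf) (\<lambda>y. y)"
    unfolding faces_surf by blast
  moreover have "\<exists>!F. F \<in> {face s} \<and> edge_on_face (top_of_set surf) (\<lambda>y. y) e F" if "e \<in> edges" for e s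
    using edge_on_face_surf[OF that] by blast
  moreover have "bounded_by_circuits edges (top_of_set surf) (\<lambda>y. y) {face s} {circuit_list s}" for s
    unfolding bounded_by_circuits_def
    by (intro exI[of _ "\<lambda>_. circuit_list s"]) (simp add: face_boundary_surf bij_betw_def)
  ultimately show ?case
    by (rule_tac x = "{face True}" in exI, rule_tac x = "{face False}" in exI,
        rule_tac x = "{circuit_list True}" in exI, rule_tac x = "{circuit_list False}" in exI)
       (intro conjI ballI circuit_decomposition_list)
qed

lemma face_length_surf:
  assumes "F \<in> faces {..<v} edges (top_of_set surf) (\<lambda>y. y)"
  shows "face_has_length edges (top_of_set surf) (\<lambda>y. y) F N"
  using assms face_boundary_surf length_circuit_list unfolding faces_surf face_has_length_def by blast

end

theorem theorem6p6:
  fixes n k :: nat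
  assumes "odd n" and "odd k" and "1 \<le> k" and "k \<le> n"
    and "gcd n (k - 1) = 1 \<or> (3 < k \<and> k < 200) \<or> int n \<ge> (int k - 2) * (int k - 1)"
  shows "\<exists>(S :: (nat \<Rightarrow> real) topology) \<psi>.
           surface S \<and> orientable S \<and>
           biembedding {..<2*n*k+1} (complete_edges {..<2*n*k+1}) S \<psi> \<and>
           (\<forall>F \<in> faces {..<2*n*k+1} (complete_edges {..<2*n*k+1}) S \<psi>.
              \<exists>l. face_has_length (complete_edges {..<2*n*k+1}) S \<psi> F l \<and> k dvd l)"
proof -
  define m where "m = n * k"
  have v: "2 * n * k + 1 = 2 * m + 1" by (simp add: m_def)
  interpret circuit_pair "2 * m + 1" m "m * (2 * m + 1)" "label m" "corner m" "neighbour m"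
    using assms by (intro circuit_pair_complete_graph) (simp add: m_def)
  \<comment> \<open>Both faces have length \<open>N = m * (2 * m + 1)\<close>, which contains the
    factor \<open>k\<close> of \<open>m\<close>.\<close>
  have "k dvd m * (2 * m + 1)" by (simp add: m_def)
  then show ?thesis
    unfolding v using surface_surf orientable_surf biembedding_surf face_length_surf by blast
qed

end
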